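(* Let $q\ge0$, $t\ge1$ be integers. For every $d\ge1$, $$WCyc_d(q,t)=\Big|\ker\big(Cyc_d(\rho)\big)\Big|,$$ where $Cyc_d(\rho)$ is viewed as an endomorphism of the abelian group $K(\overline{W}(q,t))$, $\rho$ is the shift map, and $Cyc_d$ is the $d$-th cyclotomic polynomial.
   Context: $W_k(q,t)$ is the directed multigraph with hub $v_0$ and rim vertices $v_1,\dots,v_k$ (clockwise, indices mod $k$), with $t$ edges each way between $v_0$ and each $v_i$, one edge $v_i\to v_{i-1}$ and $q$ edges $v_i\to v_{i+1}$. Its critical group $K(W_k(q,t))$ (dollar game with bank $v_0$) is the group of critical configurations $[c_1,\dots,c_k]$ under $C_1\oplus C_2=$ the unique critical configuration reachable by legal firings from $C_1+C_2$; it is isomorphic to $\mathbb{Z}^k/\overline{M}_k\mathbb{Z}^k$ where $\overline{M}_1=[t]$, $\overline{M}_2=\begin{pmatrix}1+q+t&-1-q\\-1-q&1+q+t\end{pmatrix}$, and for $k\ge3$ $\overline{M}_k$ has diagonal entries $1+q+t$, entries $(i,i+1\bmod k)=-q$, $(i,i-1\bmod k)=-1$, others $0$. For $k_1\mid k_2$ the map $w\mapsto ww\cdots w$ ($k_2/k_1$ copies) is an injective homomorphism $K(W_{k_1}(q,t))\to K(W_{k_2}(q,t))$; $K(\overline{W}(q,t))$ is the direct limit of the $K(W_k(q,t))$ along these maps, equivalently the group of bi-infinite periodic sequences whose period block is a critical configuration of some $W_k(q,t)$. The shift map $\rho$ on $K(\overline{W}(q,t))$ shifts sequences left; on $K(W_k(q,t))$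 it is $[c_1,\dots,c_k]\mapsto[c_2,\dots,c_k,c_1]$. For $f(x)=\sum_j a_jx^j\in\mathbb{Z}[x]$, $f(\rho)=\sum_j a_j\rho^j$ as a group endomorphism. Let $\mathcal{W}_k(q,t)=\det\overline{M}_k$ (which equals $-N_k(q,-t)$, where $N_k(q,N_1)$ is the polynomial giving $\#E(\mathbb{F}_{q^k})$ for an elliptic curve $E/\mathbb{F}_q$ with $N_1$ points). The polynomials $WCyc_d(q,t)$ are defined by $WCyc_1=t$ and $WCyc_d(q,t)=ECyc_d(q,-t)$ for $d\ge2$, where the elliptic cyclotomic polynomials $ECyc_d(q,N_1)$ are the polynomials with $N_k(q,N_1)=\prod_{d\mid k}ECyc_d(q,N_1)$ for all $k$; equivalently, the $WCyc_d$ are determined recursively by $\mathcal{W}_k(q,t)=\prod_{d\mid k}WCyc_d(q,t)$ for all $k\ge1$. *)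

theory Defs
  imports
    Complex_Main
    "HOL-Algebra.Group"
    "HOL-Algebra.Coset"
    "HOL-Algebra.FiniteProduct"
    "HOL-Computational_Algebra.Polynomial"
    "Jordan_Normal_Form.Determinant"
begin

section \<open>The wheel graph and the dollar game\<close>

text \<open>
  The vertices of the wheel with \<open>k \<ge> 1\<close> rim vertices are \<open>0\<close> (the hub, which is the bank) and
  \<open>1, \<dots>, k\<close>.  The function below gives the number of edges from \<open>u\<close> to \<open>v\<close>.  For \<open>k = 2\<close> both
  rim neighbours coincide, and for \<open>k = 1\<close> the rim edges are \<open>1 + q\<close> loops; the loops
  count towards the out-degree.
\<close>

definition rim_next :: "nat \<Rightarrow> nat \<Rightarrow> nat" where
  "rim_next k i = (if i = k then 1 else i + 1)"

definition rim_prev :: "nat \<Rightarrow> nat \<Rightarrow> nat" where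
  "rim_prev k i = (if i = 1 then k else i - 1)"

definition wheel_edges :: "nat \<Rightarrow> nat \<Rightarrow> nat \<Rightarrow> nat \<Rightarrow> nat \<Rightarrow> nat" where
  "wheel_edges k q t u v =
     (if u = 0 \<and> v = 0 then 0
      else if u = 0 \<or> v = 0 then t
      else (if v = rim_prev k u then 1 else 0) + (if v = rim_next k u then q else 0))"

definition wheel_outdeg :: "nat \<Rightarrow> nat \<Rightarrow> nat \<Rightarrow> nat \<Rightarrow> nat" where
  "wheel_outdeg k q t u = (\<Sum>v\<le>k. wheel_edges k q t u v)"

text \<open>
  A configuration is the list \<open>[c\<^sub>1, \<dots>, c\<^sub>k]\<close> of the amounts on the rim vertices; the vertex \<open>i\<close>
  owns \<open>C ! (i - 1)\<close>.  The (possibly negative) amount held by the bank is not recorded.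
\<close>

definition rim_can_fire :: "nat \<Rightarrow> nat \<Rightarrow> nat \<Rightarrow> nat list \<Rightarrow> nat \<Rightarrow> bool" where
  "rim_can_fire k q t C i \<longleftrightarrow> i \<in> {1..k} \<and> wheel_outdeg k q t i \<le> C ! (i - 1)"

definition stable :: "nat \<Rightarrow> nat \<Rightarrow> nat \<Rightarrow> nat list \<Rightarrow> bool" where
  "stable k q t C \<longleftrightarrow> (\<forall>i. \<not> rim_can_fire k q t C i)"

definition legal :: "nat \<Rightarrow> nat \<Rightarrow> nat \<Rightarrow> nat list \<Rightarrow> nat \<Rightarrow> bool" where
  "legal k q t C u \<longleftrightarrow> (if u = 0 then stable k q t C else rim_can_fire k q t C u)"

text \<open>The subtraction on \<^typ>\<open>nat\<close> does not truncate when the firing is legal.\<close>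

definition fire :: "nat \<Rightarrow> nat \<Rightarrow> nat \<Rightarrow> nat list \<Rightarrow> nat \<Rightarrow> nat list" where
  "fire k q t C u =
     map (\<lambda>v. C ! (v - 1) + wheel_edges k q t u v - (if v = u then wheel_outdeg k q t u else 0))
       [1..<k + 1]"

definition fires_to :: "nat \<Rightarrow> nat \<Rightarrow> nat \<Rightarrow> nat list \<Rightarrow> nat list \<Rightarrow> bool" where
  "fires_to k q t C C' \<longleftrightarrow> length C = k \<and> (\<exists>u. legal k q t C u \<and> C' = fire k q t C u)"

definition reachable :: "nat \<Rightarrow> nat \<Rightarrow> nat \<Rightarrow> nat list \<Rightarrow> nat list \<Rightarrow> bool" where
  "reachable k q t = (fires_to k q t)\<^sup>*\<^sup>*"

definition recurrent :: "nat \<Rightarrow> nat \<Rightarrow> nat \<Rightarrow> nat list \<Rightarrow> bool" where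
  "recurrent k q t C \<longleftrightarrow> (fires_to k q t)\<^sup>+\<^sup>+ C C"

definition critical :: "nat \<Rightarrow> nat \<Rightarrow> nat \<Rightarrow> nat list \<Rightarrow> bool" where
  "critical k q t C \<longleftrightarrow> length C = k \<and> stable k q t C \<and> recurrent k q t C"

section \<open>The critical groups and their direct limit\<close>

definition critical_add :: "nat \<Rightarrow> nat \<Rightarrow> nat \<Rightarrow> nat list \<Rightarrow> nat list \<Rightarrow> nat list" where
  "critical_add k q t C1 C2 =
     (THE C. critical k q t C \<and> reachable k q t (map2 (+) C1 C2) C)"

definition critical_group :: "nat \<Rightarrow> nat \<Rightarrow> nat \<Rightarrow> nat list monoid" where
  "critical_group k q t =
     \<lparr>carrier = {C. critical k q t C},
      monoid.mult = critical_add k q t,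
      one = (THE E. critical k q t E \<and> (\<forall>C. critical k q t C \<longrightarrow> critical_add k q t E C = C))\<rparr>"

definition periodic_seq :: "nat list \<Rightarrow> int \<Rightarrow> nat" where
  "periodic_seq w n = w ! nat (n mod int (length w))"

text \<open>
  The direct limit of the critical groups along the maps \<open>w \<mapsto> w \<cdots> w\<close>, realised as the group of
  bi-infinite periodic sequences with a critical period block: two sequences are added in any
  critical group whose index is a common period, and the neutral element
  is the image of the neutral element for \<open>k = 1\<close>.
\<close>

definition limit_group :: "nat \<Rightarrow> nat \<Rightarrow> (int \<Rightarrow> nat) monoid" where
  "limit_group q t =
     \<lparr>carrier = (\<Union>k\<in>{1..}. periodic_seq ` carrier (critical_group k q t)),
      monoid.mult = (\<lambda>r s. THE x. \<exists>k\<ge>1. \<exists>v\<in>carrier (critical_group k q t).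
                \<exists>w\<in>carrier (critical_group k q t).
                  r = periodic_seq v \<and> s = periodic_seq w \<and>
                  x = periodic_seq (v \<otimes>\<^bsub>critical_group k q t\<^esub> w)),
      one = periodic_seq \<one>\<^bsub>critical_group 1 q t\<^esub>\<rparr>"

definition shift :: "(int \<Rightarrow> nat) \<Rightarrow> int \<Rightarrow> nat" where
  "shift s n = s (n + 1)"

text \<open>\<open>f(\<phi>) = \<Sum>\<^sub>j a\<^sub>j \<phi>\<^sup>j\<close> for an endomorphism \<open>\<phi>\<close> of an abelian group that is written multiplicatively.\<close>

definition poly_endo :: "('a, 'b) monoid_scheme \<Rightarrow> int poly \<Rightarrow> ('a \<Rightarrow> 'a) \<Rightarrow> 'a \<Rightarrow> 'a" where
  "poly_endo G f \<phi> x = finprod G (\<lambda>j. (\<phi> ^^ j) x [^]\<^bsub>G\<^esub> (coeff f j :: int)) {..degree f}"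

section \<open>Cyclotomic and wheel cyclotomic polynomials\<close>

definition primitive_roots :: "nat \<Rightarrow> complex set" where
  "primitive_roots d = {z. z ^ d = 1 \<and> (\<forall>m. 0 < m \<and> m < d \<longrightarrow> z ^ m \<noteq> 1)}"

definition cyclotomic :: "nat \<Rightarrow> int poly" where
  "cyclotomic d = (THE p. map_poly of_int p = (\<Prod>z\<in>primitive_roots d. [:- z, 1:]))"

text \<open>
  The ring \<open>\<int>[q, t]\<close> is represented by \<^typ>\<open>int poly poly\<close>, with \<open>q\<close> as the inner and \<open>t\<close> as the
  outer indeterminate.
\<close>

definition var_q :: "int poly poly" where
  "var_q = [:[:0, 1:]:]"

definition var_t :: "int poly poly" where
  "var_t = [:0, 1:]"

definition eval_qt :: "int poly poly \<Rightarrow> int \<Rightarrow> int \<Rightarrow> int" where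
  "eval_qt P q t = poly (poly P [:t:]) q"

text \<open>
  The summands add up where index conditions coincide, so that the matrix is \<open>[t]\<close> for \<open>k = 1\<close> and
  has the off-diagonal entries \<open>- 1 - q\<close> for \<open>k = 2\<close>.
\<close>

definition wheel_matrix :: "nat \<Rightarrow> int poly poly mat" where
  "wheel_matrix k = mat k k (\<lambda>(i, j).
     (if i = j then 1 + var_q + var_t else 0)
     - (if j = (i + 1) mod k then var_q else 0)
     - (if i = (j + 1) mod k then 1 else 0))"

definition wheel_poly :: "nat \<Rightarrow> int poly poly" where
  "wheel_poly k = det (wheel_matrix k)"

text \<open>
  The polynomials \<open>WCyc\<^sub>d\<close> with \<open>det M\<^sub>k = \<Prod>\<^sub>d\<^sub>|\<^sub>k WCyc\<^sub>d\<close> for all \<open>k \<ge> 1\<close>; the value at the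
  meaningless index \<open>0\<close> is fixed to make the family unique.
\<close>

definition WCyc :: "nat \<Rightarrow> int poly poly" where
  "WCyc = (THE F. F 0 = 0 \<and> (\<forall>k\<ge>1. wheel_poly k = (\<Prod>d | d dvd k. F d)))"

end

theory Submission
  imports Defs "Jordan_Normal_Form.Char_Poly"
begin

text \<open>
  Firing acts on periodic integer sequences through the operator \<open>\<Delta>\<close> (\<open>lap\<close> below), which is injective by
  a maximum principle. Every class of periodic sequences modulo the image of \<open>\<Delta>\<close> contains exactly one
  critical sequence, and criticality does not depend on the chosen period, so the limit group is
  the group of periodic sequences modulo \<open>\<Delta>\<close>. Let \<open>\<kappa>(f)\<close> be the order of the kernel of \<open>f(\<rho>)\<close> on it.
  If \<open>f g\<close> divides \<open>x\<^sup>k - 1\<close>, then \<open>f(\<rho>)\<close> maps the kernel of \<open>(f g)(\<rho>)\<close> onto the kernel of \<open>g(\<rho>)\<close>, whence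
  \<open>\<kappa>(f g) = \<kappa>(f) \<kappa>(g)\<close>. The kernel of \<open>\<rho>\<^sup>k - 1\<close> consists of the \<open>k\<close>-periodic critical sequences, and their
  number is the index of a lattice, that is \<open>|det M\<^sub>k|\<close>. Hence the numbers \<open>\<kappa>(Cyc\<^sub>d)\<close> satisfy the recursion
  that determines the values of \<open>WCyc\<^sub>d\<close>. These values are positive, because over the complex numbers
  \<open>WCyc\<^sub>d\<close> is the product of the eigenvalues \<open>1 + q + t - q z - 1/z\<close> of the circulant matrix over the
  primitive \<open>d\<close>-th roots of unity \<open>z\<close>.
\<close>

text \<open>Multiplicativity of \<open>\<kappa>\<close> rests on a lift from classes to sequences.
  Firing commutes with \<open>\<rho>\<close> and is injective, so for \<open>f\<close> dividing some
  \<open>x^k - 1\<close> a class killed by \<open>f(\<rho>)\<close> contains a sequence that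
  \<open>f(\<rho>)\<close> kills exactly. Surjectivity then becomes a question about integer
  sequences, where a preimage can be written down. The structure of the finite groups is never
  analysed; only orders are counted.

  The definite descriptions behind \<open>cyclotomic\<close> and \<open>WCyc\<close> say something
  only once integral factors are known to exist. Complex products over primitive roots supply the
  factors, and division by monic polynomials supplies integrality. For \<open>WCyc\<close> this
  works because every eigenvalue is monic of degree 1 in \<open>t\<close>, the outer indeterminate.

  The recursion over divisors determines a family of numbers only if no factor vanishes. This is one
  reason for proving positivity; the other is that a lattice index gives the determinant only up to
  sign.\<close>

section \<open>Products over divisors\<close>

text \<open>Division by a monic \<open>p\<close> introduces no denominators, so the division of
  \<open>r\<close> by \<open>p\<close> survives the passage to the larger domain. If
  \<open>s\<close> were not the image of the quotient, the remainder would be a nonzero multiple of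
  \<open>p\<close> of too small a degree.\<close>

lemma (in inj_idom_hom) monic_quotient_in_image:
  fixes p r :: "'a poly" and s :: "'b poly"
  assumes p: "lead_coeff p = 1" and eq: "map_poly hom p * s = map_poly hom r"
  shows "\<exists>s'. map_poly hom s' = s"
proof -
  interpret mp: map_poly_inj_idom_hom hom ..
  obtain u v where uv: "pseudo_divmod r p = (u, v)" by force
  have p0: "p \<noteq> 0" using p by auto
  from pseudo_divmod[OF p0 uv] p have r: "r = p * u + v" and v: "v = 0 \<or> degree v < degree p"
    by simp_all
  have e: "map_poly hom p * (s - map_poly hom u) = map_poly hom v"
    using eq unfolding r by (simp add: hom_distribs algebra_simps)
  have "s - map_poly hom u = 0"
  proof (rule ccontr)
    assume s: "s - map_poly hom u \<noteq> 0"
    have "map_poly hom p \<noteq> 0" using p0 by simp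
    hence "degree (map_poly hom v) = degree (map_poly hom p) + degree (s - map_poly hom u)"
      and "map_poly hom v \<noteq> 0"
      using s unfolding e[symmetric] by (simp_all add: degree_mult_eq)
    with v show False by simp
  qed
  thus ?thesis by (intro exI[of _ u]) simp
qed

lemma finite_divisors: "k \<ge> 1 \<Longrightarrow> finite {d::nat. d dvd k}"
  by (rule finite_subset[of _ "{..k}"]) (auto dest: dvd_imp_le)

lemma prod_divisors_split:
  fixes f :: "nat \<Rightarrow> 'a :: comm_monoid_mult"
  assumes "k \<ge> 1"
  shows "(\<Prod>d | d dvd k. f d) = f k * (\<Prod>d | d dvd k \<and> d \<noteq> k. f d)"
proof -
  have "{d. d dvd k} = insert k {d. d dvd k \<and> d \<noteq> k}" by auto
  moreover have "finite {d. d dvd k \<and> d \<noteq> k}"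
    using finite_divisors[OF assms] by (rule rev_finite_subset) auto
  ultimately show ?thesis by simp
qed

lemma proper_divisor_bounds: "k \<ge> 1 \<Longrightarrow> d dvd k \<Longrightarrow> d \<noteq> k \<Longrightarrow> 1 \<le> d \<and> d < (k::nat)"
  by (cases d) (auto dest: dvd_imp_le)

text \<open>By strong induction \<open>G k\<close> is the quotient of the image of
  \<open>r k\<close> by the monic product over the proper divisors. The lemma serves integers inside
  the complex numbers (\<open>cyclotomic\<close>) and integer polynomials in \<open>q\<close> inside
  complex ones (\<open>WCyc\<close>).\<close>

lemma (in inj_idom_hom) divisor_factors_in_image:
  fixes r :: "nat \<Rightarrow> 'a poly" and G :: "nat \<Rightarrow> 'b poly"
  assumes monic: "\<And>d. lead_coeff (G d) = 1"
    and prod: "\<And>k. k \<ge> 1 \<Longrightarrow> (\<Prod>d | d dvd k. G d) = map_poly hom (r k)"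
    and k: "k \<ge> 1"
  shows "\<exists>p. map_poly hom p = G k"
  using k
proof (induction k rule: less_induct)
  case (less k)
  interpret mp: map_poly_inj_idom_hom hom ..
  let ?D = "{d. d dvd k \<and> d \<noteq> k}"
  have "\<exists>p. map_poly hom p = G d" if "d \<in> ?D" for d
    using less.IH[of d] proper_divisor_bounds[of k d] that less.prems by auto
  then obtain F where F: "\<And>d. d \<in> ?D \<Longrightarrow> map_poly hom (F d) = G d" by metis
  have "map_poly hom (\<Prod>d\<in>?D. F d) = (\<Prod>d\<in>?D. G d)"
    by (simp add: mp.hom_prod F)
  moreover have "lead_coeff (\<Prod>d\<in>?D. F d) = 1"
  proof -
    have "hom (lead_coeff (F d)) = hom 1" if "d \<in> ?D" for d
      using arg_cong[OF F[OF that], of lead_coeff] monic[of d] by simp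
    hence "lead_coeff (F d) = 1" if "d \<in> ?D" for d using that by (meson injectivity)
    thus ?thesis unfolding lead_coeff_prod by (auto intro: prod.neutral)
  qed
  ultimately show ?case
    using prod[OF less.prems] prod_divisors_split[OF less.prems, of G]
    by (intro monic_quotient_in_image) (auto simp: mult.commute)
qed

section \<open>Roots of unity\<close>

lemma primitive_roots_subset: "primitive_roots d \<subseteq> {z. z ^ d = 1}"
  by (auto simp: primitive_roots_def)

lemma finite_primitive_roots: "d \<ge> 1 \<Longrightarrow> finite (primitive_roots d)"
  using finite_subset[OF primitive_roots_subset finite_roots_unity] by simp

lemma primitive_roots_disjoint:
  assumes "z \<in> primitive_roots d" "z \<in> primitive_roots e" "d \<ge> 1" "e \<ge> 1"
  shows "d = e"
proof -
  have "\<not> d < e" "\<not> e < d" using assms by (auto simp: primitive_roots_def)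
  thus ?thesis by simp
qed

lemma roots_unity_eq_UN_primitive_roots:
  assumes k: "k \<ge> 1"
  shows "{z::complex. z ^ k = 1} = (\<Union>d\<in>{d. d dvd k}. primitive_roots d)"
proof (intro equalityI subsetI)
  fix z :: complex assume "z \<in> {z. z ^ k = 1}"
  hence z: "z ^ k = 1" by simp
  define d where "d = (LEAST d. d > 0 \<and> z ^ d = 1)"
  have d: "d > 0 \<and> z ^ d = 1"
    unfolding d_def by (rule LeastI[of _ k]) (use z k in auto)
  have least: "d \<le> m" if "m > 0" "z ^ m = 1" for m
    unfolding d_def using that by (intro Least_le) auto
  have "z ^ (k mod d) = 1"
  proof -
    have "z ^ k = (z ^ d) ^ (k div d) * z ^ (k mod d)"
      by (simp flip: power_mult power_add)
    thus ?thesis using z d by simp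
  qed
  hence "k mod d = 0" using least[of "k mod d"] d mod_less_divisor[of d k] by linarith
  moreover have "z \<in> primitive_roots d"
    unfolding primitive_roots_def using d least leD by blast
  ultimately show "z \<in> (\<Union>d\<in>{d. d dvd k}. primitive_roots d)" by auto
next
  fix z assume "z \<in> (\<Union>d\<in>{d. d dvd k}. primitive_roots d)"
  thus "z \<in> {z. z ^ k = 1}" by (auto simp: primitive_roots_def dvd_def power_mult)
qed

lemma prod_roots_unity_eq_prod_primitive_roots:
  fixes f :: "complex \<Rightarrow> 'a :: comm_monoid_mult"
  assumes k: "k \<ge> 1"
  shows "(\<Prod>z | z ^ k = 1. f z) = (\<Prod>d | d dvd k. \<Prod>z\<in>primitive_roots d. f z)"
proof -
  have pos: "d \<ge> 1" if "d dvd k" for d using that k by (cases d) auto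
  have disj: "primitive_roots i \<inter> primitive_roots j = {}" if "i dvd k" "j dvd k" "i \<noteq> j" for i j
    using primitive_roots_disjoint[OF _ _ pos[OF that(1)] pos[OF that(2)]] that(3) by blast
  show ?thesis unfolding roots_unity_eq_UN_primitive_roots[OF k]
    by (rule prod.UNION_disjoint)
       (simp_all add: finite_divisors[OF k] finite_primitive_roots[OF pos] disj)
qed

text \<open>The coefficients at \<open>x^k\<close> agree, so the difference has degree below
  \<open>k\<close> and cannot vanish at all \<open>k\<close> roots of unity without being
  zero.\<close>

lemma prod_roots_unity_linear:
  assumes k: "k \<ge> 1"
  shows "(\<Prod>z | z ^ k = 1. [:- z, 1:]) = (monom 1 k - 1 :: complex poly)"
proof (rule ccontr)
  let ?R = "{z::complex. z ^ k = 1}" and ?m = "monom 1 k - 1 :: complex poly"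
  let ?p = "\<Prod>z\<in>?R. [:- z, 1:]"
  assume ne: "?p \<noteq> ?m"
  have fin: "finite ?R" using k by (intro finite_roots_unity) auto
  have card: "card ?R = k" using k by (intro card_roots_unity_eq) auto
  have degp: "degree ?p = k" using card by (simp add: degree_prod_eq_sum_degree)
  have cm: "coeff ?m k = 1" using k by simp
  have degm: "degree ?m \<le> k" by (rule degree_diff_le) (simp_all add: degree_monom_le)
  have "lead_coeff ?p = 1" by (simp add: lead_coeff_prod)
  hence "coeff (?p - ?m) k = 0" unfolding degp using cm by simp
  moreover have "degree (?p - ?m) \<le> k" using degp degm degree_diff_le[of ?p k ?m] by simp
  ultimately have deg: "degree (?p - ?m) < k"
    using ne by (metis eq_iff_diff_eq_0 le_neq_implies_less leading_coeff_0_iff)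
  have "poly (?p - ?m) z = 0" if "z \<in> ?R" for z
    using that fin by (simp add: poly_prod poly_monom prod_zero_iff)
  hence "?R \<subseteq> {z. poly (?p - ?m) z = 0}" by auto
  hence "k \<le> card {z. poly (?p - ?m) z = 0}"
    using card ne poly_roots_finite[of "?p - ?m"] card_mono by (metis eq_iff_diff_eq_0)
  also have "\<dots> \<le> degree (?p - ?m)" using ne by (intro card_poly_roots_bound) auto
  finally show False using deg by simp
qed

section \<open>Cyclotomic polynomials\<close>

text \<open>This justifies the definite description in \<open>cyclotomic\<close>: existence is
  integrality, uniqueness is injectivity of the embedding into complex polynomials.\<close>

lemma map_poly_cyclotomic:
  assumes d: "d \<ge> 1"
  shows "map_poly of_int (cyclotomic d) = (\<Prod>z\<in>primitive_roots d. [:- z, 1:] :: complex poly)"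
proof -
  let ?G = "\<lambda>d. (\<Prod>z\<in>primitive_roots d. [:- z, 1:] :: complex poly)"
  have "\<exists>p. map_poly of_int p = ?G d"
  proof (rule of_int_hom.divisor_factors_in_image[of _ "\<lambda>k. monom 1 k - 1"])
    show "lead_coeff (?G d) = 1" for d by (simp add: lead_coeff_prod)
    show "(\<Prod>d | d dvd k. ?G d) = map_poly of_int (monom 1 k - 1)" if "k \<ge> 1" for k
      using prod_roots_unity_linear[OF that] prod_roots_unity_eq_prod_primitive_roots[OF that, of "\<lambda>z. [:- z, 1:]"]
      by (simp add: hom_distribs)
  qed fact
  then obtain p where "map_poly of_int p = ?G d" by auto
  thus ?thesis unfolding cyclotomic_def
    by (intro theI[of "\<lambda>p. map_poly of_int p = ?G d" p]) (auto intro: of_int_poly_hom.injectivity[where ?'a = complex])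
qed

lemma prod_cyclotomic:
  assumes k: "k \<ge> 1"
  shows "(\<Prod>d | d dvd k. cyclotomic d) = monom 1 k - 1"
proof -
  have pos: "d \<ge> 1" if "d dvd k" for d using that k by (cases d) auto
  have "map_poly of_int (\<Prod>d | d dvd k. cyclotomic d) = (map_poly of_int (monom 1 k - 1) :: complex poly)"
    using prod_roots_unity_linear[OF k] prod_roots_unity_eq_prod_primitive_roots[OF k, of "\<lambda>z. [:- z, 1:]"]
    by (simp add: hom_distribs of_int_poly_hom.hom_prod map_poly_cyclotomic[OF pos])
  thus ?thesis by simp
qed

section \<open>Factorization of the wheel determinant\<close>

text \<open>The element \<open>1 + q + t - q z - 1/z\<close> of \<open>\<complex>[q][t]\<close>.\<close>

definition wheel_eigenvalue :: "complex \<Rightarrow> complex poly poly" where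
  "wheel_eigenvalue z = [:[:1 - inverse z, 1 - z:], 1:]"

interpretation of_int_poly2_hom: map_poly_inj_idom_hom "map_poly of_int :: int poly \<Rightarrow> complex poly" ..

text \<open>Column \<open>j\<close> of the Fourier matrix \<open>V\<close> is an eigenvector of the
  circulant matrix for \<open>wheel_eigenvalue (w ^ j)\<close>. From \<open>M * V = V * D\<close>
  and \<open>det V \<noteq> 0\<close> the determinants of \<open>M\<close> and \<open>D\<close>
  agree by cancellation in a domain, without inverting \<open>V\<close>.\<close>

lemma det_circulant_wheel:
  assumes k: "k \<ge> 1"
  shows "map_poly (map_poly of_int) (wheel_poly k) = (\<Prod>z | z ^ k = 1. wheel_eigenvalue z)"
proof -
  let ?h = "map_poly (map_poly of_int) :: int poly poly \<Rightarrow> complex poly poly"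
  define w where "w = cis (2 * pi / real k)"
  have w: "w ^ j = cis (2 * pi * real j / real k)" for j
    by (simp add: w_def Complex.DeMoivre mult_ac)
  have bij: "bij_betw (\<lambda>j. w ^ j) {..<k} {z. z ^ k = 1}"
    unfolding w by (rule bij_betw_roots_unity) (use k in auto)
  have wk: "w ^ k = 1" unfolding w using k by simp
  have w0: "w \<noteq> 0" by (simp add: w_def)
  let ?C = "\<lambda>z::complex. [:[:z:]:]"
  define M where "M = map_mat ?h (wheel_matrix k)"
  define V where "V = mat k k (\<lambda>(i, j). ?C (w ^ (i * j)))"
  define U where "U = mat k k (\<lambda>(i, j). ?C (inverse w ^ (i * j)))"
  define D where "D = mat k k (\<lambda>(i, j). if i = j then wheel_eigenvalue (w ^ j) else 0)"
  have carr: "M \<in> carrier_mat k k" "V \<in> carrier_mat k k" "U \<in> carrier_mat k k" "D \<in> carrier_mat k k"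
    by (auto simp: M_def V_def U_def D_def wheel_matrix_def)
  have h: "?h var_q = [:[:0, 1:]:]" "?h var_t = [:0, 1:]"
    by (simp_all add: var_q_def var_t_def map_poly_pCons)
  have sumC: "(\<Sum>i\<in>A. ?C (f i)) = ?C (\<Sum>i\<in>A. f i)" for A :: "nat set" and f
    by (induction A rule: infinite_finite_induct) auto
  have "M * V = V * D"
  proof (rule eq_matI)
    fix i j assume "i < dim_row (V * D)" "j < dim_col (V * D)"
    hence ij: "i < k" "j < k" using carr by auto
    have wmod: "w ^ (i mod k * j) = w ^ (i * j)" for i
    proof -
      have "i * j = k * (i div k * j) + i mod k * j"
        by (metis distrib_right mult.assoc mult_div_mod_eq)
      hence "w ^ (i * j) = (w ^ k) ^ (i div k * j) * w ^ (i mod k * j)"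
        by (metis power_add power_mult)
      thus ?thesis by (simp add: wk)
    qed
    \<comment> \<open>The predecessor of \<open>i\<close> modulo \<open>k\<close>, written with
      \<open>k - 1\<close> to stay within natural numbers.\<close>
    define p where "p = (i + (k - 1)) mod k"
    have p: "p < k" using k by (simp add: p_def)
    have pw: "w ^ (p * j) = w ^ (i * j) * inverse (w ^ j)"
    proof -
      have "w ^ (p * j) * w ^ j = w ^ ((p + 1) * j)" by (simp add: algebra_simps power_add)
      also have "\<dots> = w ^ ((p + 1) mod k * j)" by (rule wmod[symmetric])
      also have "(p + 1) mod k = i" using k ij unfolding p_def by (simp add: mod_simps)
      finally show ?thesis using w0 by (simp add: field_simps)
    qed
    have pred: "i = (l + 1) mod k \<longleftrightarrow> l = p" if "l < k" for l
    proof
      assume "i = (l + 1) mod k"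
      hence "p = (l + 1 + (k - 1)) mod k" unfolding p_def by (simp add: mod_simps)
      thus "l = p" using that k by simp
    next
      assume "l = p"
      thus "i = (l + 1) mod k" using k ij unfolding p_def by (simp add: mod_simps)
    qed
    have "(M * V) $$ (i, j) = (\<Sum>l<k. ((if i = l then ?h (1 + var_q + var_t) else 0)
        - (if l = (i + 1) mod k then ?h var_q else 0) - (if l = p then 1 else 0)) * ?C (w ^ (l * j)))"
      using ij carr pred by (auto simp: M_def V_def wheel_matrix_def scalar_prod_def
        atLeast0LessThan hom_distribs intro!: sum.cong)
    \<comment> \<open>The three conditions are summed separately, so the coinciding neighbours for
      \<open>k = 1\<close> and \<open>k = 2\<close> need no case distinction.\<close>
    also have "\<dots> = ?h (1 + var_q + var_t) * ?C (w ^ (i * j)) - ?h var_q * ?C (w ^ ((i + 1) mod k * j))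
        - ?C (w ^ (p * j))"
      unfolding left_diff_distrib sum_subtractf if_distrib[of "\<lambda>x. x * _"] mult_zero_left mult_1
      using ij p k by (simp del: mult_pCons_right mult_pCons_left)
    also have "\<dots> = ?C (w ^ (i * j)) * wheel_eigenvalue (w ^ j)"
      unfolding wmod pw by (simp add: hom_distribs h wheel_eigenvalue_def
          one_pCons algebra_simps power_add)
    also have "\<dots> = (V * D) $$ (i, j)"
      using ij carr by (simp add: V_def D_def scalar_prod_def atLeast0LessThan if_distrib cong: if_cong)
    finally show "(M * V) $$ (i, j) = (V * D) $$ (i, j)" .
  qed (use carr in auto)
  hence "det M * det V = det V * det D" using carr by (metis det_mult)
  moreover have "det V \<noteq> 0"
  proof -
    \<comment> \<open>Orthogonality of the characters of the cyclic group: off the diagonal a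
      geometric sum over a nontrivial \<open>k\<close>-th root of unity vanishes.\<close>
    have "V * U = ?C (of_nat k) \<cdot>\<^sub>m 1\<^sub>m k"
    proof (rule eq_matI)
      fix i j assume "i < dim_row (?C (of_nat k) \<cdot>\<^sub>m 1\<^sub>m k)" "j < dim_col (?C (of_nat k) \<cdot>\<^sub>m 1\<^sub>m k)"
      hence ij: "i < k" "j < k" by auto
      define x where "x = w ^ i * inverse w ^ j"
      have "(V * U) $$ (i, j) = (\<Sum>l<k. ?C (w ^ (i * l) * inverse w ^ (l * j)))"
        using ij carr by (simp add: V_def U_def scalar_prod_def atLeast0LessThan mult_ac)
      also have "\<dots> = ?C (\<Sum>l<k. x ^ l)"
        unfolding sumC x_def by (simp add: power_mult_distrib flip: power_mult) (simp add: mult.commute)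
      also have "(\<Sum>l<k. x ^ l) = (if i = j then of_nat k else 0)"
      proof (cases "i = j")
        case True
        hence "x = 1" using w0 by (simp add: x_def field_simps)
        thus ?thesis using True by simp
      next
        case False
        have "w ^ i \<noteq> w ^ j" using bij ij False by (auto simp: bij_betw_def inj_on_def)
        hence "x \<noteq> 1" using w0 by (simp add: x_def field_simps)
        moreover have "x ^ k = 1"
          unfolding x_def power_mult_distrib by (simp add: wk flip: power_mult) (simp add: wk power_mult mult.commute[of _ k] power_inverse)
        ultimately show ?thesis using False by (simp add: geometric_sum)
      qed
      finally show "(V * U) $$ (i, j) = (?C (of_nat k) \<cdot>\<^sub>m 1\<^sub>m k) $$ (i, j)" using ij by simp
    qed (use carr in auto)
    hence "det V * det U = ?C (of_nat k) ^ k" using carr by (metis det_mult det_smult det_one index_one_mat(3) mult.right_neutral)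
    thus ?thesis using k by auto
  qed
  ultimately have "det M = det D" by (simp add: mult.commute)
  also have "\<dots> = prod_list (diag_mat D)"
    by (rule det_lower_triangular[OF _ carr(4)]) (simp add: D_def)
  also have "\<dots> = (\<Prod>j<k. wheel_eigenvalue (w ^ j))"
    by (simp add: diag_mat_def D_def prod.list_conv_set_nth atLeast0LessThan)
  also have "\<dots> = (\<Prod>z | z ^ k = 1. wheel_eigenvalue z)"
    by (rule prod.reindex_bij_betw[OF bij])
  finally show ?thesis unfolding M_def wheel_poly_def by (simp add: of_int_poly2_hom.hom_det)
qed

text \<open>A family \<open>F\<close> of integral factors is chosen and shown to be the only
  solution of the recursion: the products over proper divisors are nonzero and can be
  cancelled.\<close>

lemma WCyc_properties:
  shows prod_WCyc: "k \<ge> 1 \<Longrightarrow> wheel_poly k = (\<Prod>d | d dvd k. WCyc d)"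
    and map_poly_WCyc: "d \<ge> 1 \<Longrightarrow>
      map_poly (map_poly of_int) (WCyc d) = (\<Prod>z\<in>primitive_roots d. wheel_eigenvalue z)"
proof -
  let ?h = "map_poly (map_poly of_int) :: int poly poly \<Rightarrow> complex poly poly"
  let ?G = "\<lambda>d. \<Prod>z\<in>primitive_roots d. wheel_eigenvalue z"
  have Gprod: "(\<Prod>d | d dvd k. ?G d) = ?h (wheel_poly k)" if "k \<ge> 1" for k
    using det_circulant_wheel[OF that] prod_roots_unity_eq_prod_primitive_roots[OF that, of wheel_eigenvalue]
    by simp
  have ex: "\<exists>p. ?h p = ?G d" if "d \<ge> 1" for d
    by (rule of_int_poly_hom.divisor_factors_in_image[OF _ Gprod that])
       (simp_all add: lead_coeff_prod wheel_eigenvalue_def)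
  \<comment> \<open>The value at index \<open>0\<close> must match the convention that makes the
    family in \<open>WCyc\<close> unique.\<close>
  define F where "F d = (if d = 0 then 0 else SOME p. ?h p = ?G d)" for d
  have hF: "?h (F d) = ?G d" if "d \<ge> 1" for d
    using someI_ex[OF ex[OF that]] that by (simp add: F_def)
  let ?P = "\<lambda>F. F 0 = 0 \<and> (\<forall>k\<ge>1. wheel_poly k = (\<Prod>d | d dvd k. F d))"
  have pos: "d \<ge> 1" if "d dvd k" "k \<ge> 1" for d k :: nat using that by (cases d) auto
  have "?h (wheel_poly k) = ?h (\<Prod>d | d dvd k. F d)" if "k \<ge> 1" for k
    using Gprod[OF that] hF pos[OF _ that] by (simp add: of_int_poly2_hom.hom_prod)
  hence PF: "?P F" by (simp add: F_def)
  have F0: "F d \<noteq> 0" if "d \<ge> 1" for d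
  proof
    assume "F d = 0"
    hence "?G d = 0" using hF[OF that] by simp
    thus False using finite_primitive_roots[OF that] by (simp add: prod_zero_iff wheel_eigenvalue_def)
  qed
  have uniq: "F' = F" if PF': "?P F'" for F'
  proof
    fix d show "F' d = F d"
    proof (induction d rule: less_induct)
      case (less d)
      show ?case
      proof (cases "d = 0")
        case False
        hence d: "d \<ge> 1" by simp
        let ?D = "{e. e dvd d \<and> e \<noteq> d}"
        have "F' d * (\<Prod>e\<in>?D. F' e) = F d * (\<Prod>e\<in>?D. F e)"
          using PF PF' d prod_divisors_split[OF d, of F] prod_divisors_split[OF d, of F'] by metis
        moreover have "(\<Prod>e\<in>?D. F' e) = (\<Prod>e\<in>?D. F e)"
          using less proper_divisor_bounds[OF d] by (intro prod.cong) auto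
        moreover have "(\<Prod>e\<in>?D. F e) \<noteq> 0"
          using F0 proper_divisor_bounds[OF d] finite_divisors[OF d] by (auto simp: prod_zero_iff)
        ultimately show ?thesis by simp
      qed (use PF PF' in simp)
    qed
  qed
  have "WCyc = F" unfolding WCyc_def by (rule the_equality[of ?P, OF PF uniq])
  thus "k \<ge> 1 \<Longrightarrow> wheel_poly k = (\<Prod>d | d dvd k. WCyc d)" "d \<ge> 1 \<Longrightarrow> ?h (WCyc d) = ?G d"
    using PF hF by auto
qed

lemma eval_qt_hom: "comm_ring_hom (\<lambda>P. eval_qt P q t)"
  by unfold_locales (simp_all add: eval_qt_def)

lemma of_int_eval_qt:
  "of_int (eval_qt P q t) = poly (poly (map_poly (map_poly of_int) P) [:of_int t:]) (of_int q :: complex)"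
proof -
  have "of_int (eval_qt P q t) = poly (map_poly of_int (poly P [:t:])) (of_int q :: complex)"
    unfolding eval_qt_def by (rule of_int_hom.poly_map_poly[symmetric])
  also have "map_poly of_int (poly P [:t:]) = poly (map_poly (map_poly of_int) P) (map_poly of_int [:t:] :: complex poly)"
    by (rule of_int_poly_hom.poly_map_poly[symmetric])
  finally show ?thesis unfolding of_int_hom.map_poly_pCons_hom by simp
qed

text \<open>Nonreal primitive roots come in conjugate pairs, and their factors multiply to a squared
  modulus; at a real root the factor is a positive real number.\<close>

lemma eval_qt_WCyc_pos:
  fixes q t d :: nat
  assumes t: "t \<ge> 1" and d: "d \<ge> 1"
  shows "eval_qt (WCyc d) (int q) (int t) > 0"
proof -
  define f where "f z = (1 + of_nat q + of_nat t - of_nat q * z - inverse z :: complex)" for z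
  let ?R = "primitive_roots d"
  let ?P = "{z\<in>?R. Im z > 0}" and ?N = "{z\<in>?R. Im z < 0}" and ?Z = "{z\<in>?R. Im z = 0}"
  have fin: "finite ?R" by (rule finite_primitive_roots[OF d])
  have norm: "cmod z = 1" if "z \<in> ?R" for z
  proof -
    have "cmod z ^ d = 1" using that by (simp add: primitive_roots_def flip: norm_power)
    thus ?thesis using d power_eq_1_iff[of "cmod z" d] by auto
  qed
  have cnjR: "cnj z \<in> ?R" if "z \<in> ?R" for z
    using that by (auto simp: primitive_roots_def simp flip: complex_cnj_power)
  \<comment> \<open>On the unit circle the real part of \<open>q z + 1/z\<close> is at most
    \<open>q + 1\<close>, and \<open>t \<ge> 1\<close> leaves a positive rest.\<close>
  have re: "Re (f z) > 0" if "z \<in> ?R" for z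
  proof -
    have a: "\<bar>Re z\<bar> \<le> 1" "\<bar>Re (inverse z)\<bar> \<le> 1"
      using norm[OF that] abs_Re_le_cmod[of z] abs_Re_le_cmod[of "inverse z"] by (auto simp: norm_inverse)
    hence "real q * Re z \<le> real q * 1" by (intro mult_left_mono) auto
    hence "real q * Re z + Re (inverse z) < 1 + real q + real t" using a t by linarith
    thus ?thesis unfolding f_def by simp
  qed
  have "of_int (eval_qt (WCyc d) (int q) (int t)) = (\<Prod>z\<in>?R. f z)"
    unfolding of_int_eval_qt map_poly_WCyc[OF d]
    by (simp add: poly_prod wheel_eigenvalue_def f_def algebra_simps)
  also have "?R = ?Z \<union> (?P \<union> ?N)" by auto
  also have "(\<Prod>z\<in>\<dots>. f z) = (\<Prod>z\<in>?Z. f z) * ((\<Prod>z\<in>?P. f z) * (\<Prod>z\<in>?N. f z))"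
    using fin by (subst prod.union_disjoint; (subst prod.union_disjoint)?) auto
  also have "(\<Prod>z\<in>?N. f z) = (\<Prod>z\<in>?P. f (cnj z))"
    by (rule prod.reindex_bij_witness[of _ cnj cnj]) (auto intro: cnjR)
  also have "\<dots> = cnj (\<Prod>z\<in>?P. f z)" by (simp add: f_def)
  also have "(\<Prod>z\<in>?P. f z) * \<dots> = of_real ((cmod (\<Prod>z\<in>?P. f z))\<^sup>2)"
    by (rule complex_norm_square[symmetric])
  also have "(\<Prod>z\<in>?Z. f z) = of_real (\<Prod>z\<in>?Z. Re (f z))"
  proof -
    have "f z = of_real (Re (f z))" if "z \<in> ?Z" for z
      using that by (auto simp: f_def complex_eq_iff Im_divide inverse_eq_divide)
    thus ?thesis by simp
  qed
  finally have "complex_of_real (of_int (eval_qt (WCyc d) (int q) (int t))) = of_real ((\<Prod>z\<in>?Z. Re (f z)) * (cmod (\<Prod>z\<in>?P. f z))\<^sup>2)"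
    by simp
  hence eq: "real_of_int (eval_qt (WCyc d) (int q) (int t)) = (\<Prod>z\<in>?Z. Re (f z)) * (cmod (\<Prod>z\<in>?P. f z))\<^sup>2"
    unfolding of_real_eq_iff .
  have "(\<Prod>z\<in>?P. f z) \<noteq> 0" using re fin by (fastforce simp: prod_zero_iff)
  moreover have "(\<Prod>z\<in>?Z. Re (f z)) > 0" using re by (intro prod_pos) auto
  ultimately have "real_of_int (eval_qt (WCyc d) (int q) (int t)) > 0" unfolding eq by simp
  thus ?thesis by simp
qed

section \<open>The index of an integer lattice\<close>

text \<open>\<open>T\<close> represents the cosets of the column lattice of \<open>A\<close>, so its
  cardinality is the index; no quotient group has to be formed.\<close>

definition lattice_transversal :: "nat \<Rightarrow> int mat \<Rightarrow> int vec set \<Rightarrow> bool" where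
  "lattice_transversal n A T \<longleftrightarrow> T \<subseteq> carrier_vec n \<and>
     (\<forall>x\<in>carrier_vec n. \<exists>!s. s \<in> T \<and> (\<exists>v\<in>carrier_vec n. x = s + A *\<^sub>v v))"

text \<open>As \<open>A\<close> and \<open>B\<close> are right multiples of each other by integer
  matrices, their columns span the same lattice.\<close>

lemma lattice_transversal_cong:
  assumes "A \<in> carrier_mat n n" "E \<in> carrier_mat n n" "E' \<in> carrier_mat n n"
    and B: "B = A * E" and A: "A = B * E'" and T: "lattice_transversal n B T"
  shows "lattice_transversal n A T"
proof -
  have "(\<exists>v\<in>carrier_vec n. x = s + A *\<^sub>v v) \<longleftrightarrow> (\<exists>v\<in>carrier_vec n. x = s + B *\<^sub>v v)" for x s
  proof
    assume "\<exists>v\<in>carrier_vec n. x = s + A *\<^sub>v v"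
    then obtain v where v: "v \<in> carrier_vec n" "x = s + A *\<^sub>v v" by auto
    have "A *\<^sub>v v = (B * E') *\<^sub>v v" using A by simp
    also have "\<dots> = B *\<^sub>v (E' *\<^sub>v v)" using assms(1-3) B v by (intro assoc_mult_mat_vec[of _ n n _ n]) auto
    finally show "\<exists>v\<in>carrier_vec n. x = s + B *\<^sub>v v" using v assms(3) by auto
  next
    assume "\<exists>v\<in>carrier_vec n. x = s + B *\<^sub>v v"
    then obtain v where v: "v \<in> carrier_vec n" "x = s + B *\<^sub>v v" by auto
    have "B *\<^sub>v v = A *\<^sub>v (E *\<^sub>v v)" unfolding B using assms(1-3) v by (intro assoc_mult_mat_vec[of _ n n _ n]) auto
    thus "\<exists>v\<in>carrier_vec n. x = s + A *\<^sub>v v" using v assms(2) by auto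
  qed
  thus ?thesis using T unfolding lattice_transversal_def by simp
qed

lemma lattice_transversal_addcol:
  assumes A: "A \<in> carrier_mat n n" and "i < n" "j < n" "i \<noteq> j"
    and T: "lattice_transversal n (addcol a j i A) T"
  shows "lattice_transversal n A T"
proof (rule lattice_transversal_cong[OF A _ _ _ _ T])
  show "addcol a j i A = A * addrow_mat n a i j" using A assms by (intro addcol_mat) auto
  have "A = addcol (- a) j i (addcol a j i A)" using A assms(2-4) by (intro eq_matI) auto
  also have "\<dots> = addcol a j i A * addrow_mat n (- a) i j" using A assms by (intro addcol_mat[of _ n]) auto
  finally show "A = addcol a j i A * addrow_mat n (- a) i j" .
qed auto

lemma lattice_transversal_swapcols:
  assumes A: "A \<in> carrier_mat n n" and "i < n" "j < n"
    and T: "lattice_transversal n (swapcols i j A) T"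
  shows "lattice_transversal n A T"
proof (rule lattice_transversal_cong[OF A _ _ _ _ T])
  show "swapcols i j A = A * swaprows_mat n i j" using A assms by (intro swapcols_mat) auto
  have "A = swapcols i j (swapcols i j A)" using A assms(2-3) by (intro eq_matI) auto
  also have "\<dots> = swapcols i j A * swaprows_mat n i j" using A assms by (intro swapcols_mat[of _ n]) auto
  finally show "A = swapcols i j A * swaprows_mat n i j" .
qed auto

lemma mult_mat_vec_first_row_zero:
  fixes A :: "int mat"
  assumes A: "A \<in> carrier_mat (Suc m) (Suc m)" and z: "\<And>j. j < m \<Longrightarrow> A $$ (0, Suc j) = 0"
    and w: "w \<in> carrier_vec m"
  shows "A *\<^sub>v vCons b w = vCons (A $$ (0, 0) * b)
    (vec m (\<lambda>i. A $$ (Suc i, 0) * b) + mat_delete A 0 0 *\<^sub>v w)"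
proof (rule eq_vecI)
  fix i assume "i < dim_vec (vCons (A $$ (0, 0) * b) (vec m (\<lambda>i. A $$ (Suc i, 0) * b) + mat_delete A 0 0 *\<^sub>v w))"
  hence i: "i < Suc m" using A by (simp add: mat_delete_dim)
  have "(A *\<^sub>v vCons b w) $ i = (\<Sum>j<Suc m. A $$ (i, j) * vCons b w $ j)"
    using A w i by (simp add: scalar_prod_def atLeast0LessThan)
  also have "\<dots> = A $$ (i, 0) * b + (\<Sum>j<m. A $$ (i, Suc j) * w $ j)"
    unfolding sum.lessThan_Suc_shift using w by simp
  also have "\<dots> = vCons (A $$ (0, 0) * b) (vec m (\<lambda>i. A $$ (Suc i, 0) * b) + mat_delete A 0 0 *\<^sub>v w) $ i"
  proof (cases i)
    case 0
    thus ?thesis using z by simp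
  next
    case (Suc i')
    thus ?thesis using A i w by (simp add: mat_delete_def scalar_prod_def atLeast0LessThan)
  qed
  finally show "(A *\<^sub>v vCons b w) $ i = vCons (A $$ (0, 0) * b) (vec m (\<lambda>i. A $$ (Suc i, 0) * b) + mat_delete A 0 0 *\<^sub>v w) $ i" .
qed (use A in simp)

text \<open>The matrix is block lower triangular. Reducing the first coordinate modulo the corner
  entry fixes the coefficient \<open>b\<close> of the first column; what remains is a coset problem
  for the minor.\<close>

lemma lattice_transversal_first_row_zero:
  assumes A: "A \<in> carrier_mat (Suc m) (Suc m)" and z: "\<And>j. j < m \<Longrightarrow> A $$ (0, Suc j) = 0"
    and g: "A $$ (0, 0) \<noteq> 0" and T: "lattice_transversal m (mat_delete A 0 0) T"
  shows "lattice_transversal (Suc m) A ((\<lambda>(a, s). vCons a s) ` ({0..<\<bar>A $$ (0, 0)\<bar>} \<times> T))"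
  unfolding lattice_transversal_def
proof (intro conjI ballI)
  let ?g = "A $$ (0, 0)" and ?B = "mat_delete A 0 0"
  let ?T = "(\<lambda>(a, s). vCons a s) ` ({0..<\<bar>?g\<bar>} \<times> T)"
  let ?c = "\<lambda>b. vec m (\<lambda>i. A $$ (Suc i, 0) * b)"
  have B: "?B \<in> carrier_mat m m" using mat_delete_carrier[OF A] by simp
  have TC: "T \<subseteq> carrier_vec m" using T by (simp add: lattice_transversal_def)
  thus "?T \<subseteq> carrier_vec (Suc m)" by auto
  fix x :: "int vec" assume x: "x \<in> carrier_vec (Suc m)"
  then obtain x0 y where xy: "x = vCons x0 y" and y: "y \<in> carrier_vec m"
    by (cases x) auto
  have split: "(\<exists>v\<in>carrier_vec (Suc m). x = vCons a s + A *\<^sub>v v) \<longleftrightarrow>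
      (\<exists>b. \<exists>w\<in>carrier_vec m. x0 = a + ?g * b \<and> y - ?c b = s + ?B *\<^sub>v w)"
    if s: "s \<in> carrier_vec m" for a s
  proof -
    have "x = vCons a s + A *\<^sub>v vCons b w \<longleftrightarrow> x0 = a + ?g * b \<and> y - ?c b = s + ?B *\<^sub>v w"
      if w: "w \<in> carrier_vec m" for b w
    proof -
      have "vCons a s + A *\<^sub>v vCons b w = vCons (a + ?g * b) (s + (?c b + ?B *\<^sub>v w))"
        using mult_mat_vec_first_row_zero[of A m w b] A z s w B by (intro eq_vecI) (auto simp: vec_index_vCons)
      moreover have "y = s + (?c b + ?B *\<^sub>v w) \<longleftrightarrow> y - ?c b = s + ?B *\<^sub>v w"
      proof
        assume "y = s + (?c b + ?B *\<^sub>v w)"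
        thus "y - ?c b = s + ?B *\<^sub>v w" using s w B by (intro eq_vecI) auto
      next
        assume h: "y - ?c b = s + ?B *\<^sub>v w"
        have "y $ i - ?c b $ i = s $ i + (?B *\<^sub>v w) $ i" if "i < m" for i
          using arg_cong[OF h, of "\<lambda>v. v $ i"] that s y w B A by simp
        thus "y = s + (?c b + ?B *\<^sub>v w)" using s w B y by (intro eq_vecI) (auto simp: algebra_simps)
      qed
      ultimately show ?thesis unfolding xy by simp
    qed
    moreover have "(\<exists>v\<in>carrier_vec (Suc m). P v) \<longleftrightarrow> (\<exists>b. \<exists>w\<in>carrier_vec m. P (vCons b w))" for P :: "int vec \<Rightarrow> bool"
    proof
      assume "\<exists>v\<in>carrier_vec (Suc m). P v"
      then obtain v where "v \<in> carrier_vec (Suc m)" "P v" by auto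
      thus "\<exists>b. \<exists>w\<in>carrier_vec m. P (vCons b w)" by (cases v) auto
    qed auto
    ultimately show ?thesis by auto
  qed
  \<comment> \<open>Dividing by the absolute value gives a remainder in the required interval for
    either sign of the corner entry; \<open>sgn\<close> adapts the quotient to the signed
    entry.\<close>
  define a b where "a = x0 mod \<bar>?g\<bar>" and "b = sgn ?g * (x0 div \<bar>?g\<bar>)"
  have ab: "x0 = a + ?g * b"
    unfolding a_def b_def by (metis abs_sgn mod_mult_div_eq mult.assoc mult.commute)
  have a: "a \<in> {0..<\<bar>?g\<bar>}" using g by (auto simp: a_def)
  have ab_unique: "a' = a \<and> b' = b" if "a' \<in> {0..<\<bar>?g\<bar>}" "x0 = a' + ?g * b'" for a' b'
  proof -
    have "?g dvd a' - a" using ab that(2) by (intro dvdI[of _ _ "b - b'"]) (simp add: algebra_simps)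
    hence "\<bar>?g\<bar> dvd a' - a" by simp
    moreover have "\<bar>a' - a\<bar> < \<bar>?g\<bar>" using a that(1) by auto
    ultimately have "a' = a" using dvd_imp_le_int[of "a' - a" "\<bar>?g\<bar>"] by linarith
    thus ?thesis using ab that g by simp
  qed
  have ex1: "\<exists>!s. s \<in> T \<and> (\<exists>v\<in>carrier_vec m. y - ?c b = s + ?B *\<^sub>v v)"
    using T y unfolding lattice_transversal_def by simp
  then obtain s w where s: "s \<in> T" "w \<in> carrier_vec m" "y - ?c b = s + ?B *\<^sub>v w" by auto
  show "\<exists>!r. r \<in> ?T \<and> (\<exists>v\<in>carrier_vec (Suc m). x = r + A *\<^sub>v v)"
  proof (rule ex1I[of _ "vCons a s"])
    show "vCons a s \<in> ?T \<and> (\<exists>v\<in>carrier_vec (Suc m). x = vCons a s + A *\<^sub>v v)"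
      using split[of s a] s ab a TC by auto
    fix r assume r: "r \<in> ?T \<and> (\<exists>v\<in>carrier_vec (Suc m). x = r + A *\<^sub>v v)"
    then obtain a' s' where r': "r = vCons a' s'" "a' \<in> {0..<\<bar>?g\<bar>}" "s' \<in> T" by auto
    then obtain b' w' where w': "w' \<in> carrier_vec m" "x0 = a' + ?g * b'" "y - ?c b' = s' + ?B *\<^sub>v w'"
      using split[of s' a'] r TC by auto
    have "a' = a" "b' = b" using ab_unique r' w' by auto
    moreover have "s' = s" using ex1 s r' w' \<open>b' = b\<close> by blast
    ultimately show "r = vCons a s" using r' by simp
  qed
qed

text \<open>The Euclidean algorithm runs on the first row by column operations, which preserve the
  lattice and the absolute determinant. It ends with one nonzero entry; once this is swapped into
  the corner, the index and the determinant both split off that entry.\<close>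

lemma lattice_index_eq_abs_det:
  assumes "A \<in> carrier_mat n n" "det A \<noteq> 0"
  shows "\<exists>T. finite T \<and> int (card T) = \<bar>det A\<bar> \<and> lattice_transversal n A T"
  using assms
proof (induction n arbitrary: A)
  case 0
  have "carrier_vec 0 = {vNil :: int vec}" by auto
  hence "lattice_transversal 0 A {vNil}"
    unfolding lattice_transversal_def using 0 by (auto intro!: eq_vecI)
  moreover have "det A = 1" using 0 by simp
  ultimately show ?case by (intro exI[of _ "{vNil}"]) simp
next
  case (Suc m)
  from Suc.prems show ?case
  proof (induction "\<Sum>j<Suc m. nat \<bar>A $$ (0, j)\<bar>" arbitrary: A rule: less_induct)
    case less
    note A = less.prems(1)
    show ?case
    proof (cases "\<exists>i<Suc m. \<exists>j<Suc m. i \<noteq> j \<and> A $$ (0, i) \<noteq> 0 \<and> \<bar>A $$ (0, i)\<bar> \<le> \<bar>A $$ (0, j)\<bar>")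
      case True
      then obtain i j where ij: "i < Suc m" "j < Suc m" "i \<noteq> j" "A $$ (0, i) \<noteq> 0" "\<bar>A $$ (0, i)\<bar> \<le> \<bar>A $$ (0, j)\<bar>"
        by auto
      \<comment> \<open>With this sign the entry in column \<open>j\<close> shrinks in absolute
        value by exactly the absolute value of the entry in column \<open>i\<close>.\<close>
      define a where "a = - (sgn (A $$ (0, i)) * sgn (A $$ (0, j)))"
      let ?B = "addcol a j i A"
      have B: "?B \<in> carrier_mat (Suc m) (Suc m)" "det ?B = det A" using A ij by auto
      have "(\<Sum>l<Suc m. nat \<bar>?B $$ (0, l)\<bar>) < (\<Sum>l<Suc m. nat \<bar>A $$ (0, l)\<bar>)"
      proof (rule sum_strict_mono_ex1)
        have lt: "\<bar>a * A $$ (0, i) + A $$ (0, j)\<bar> < \<bar>A $$ (0, j)\<bar>"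
          using ij(4,5) unfolding a_def by (auto simp: sgn_if)
        show "\<forall>l\<in>{..<Suc m}. nat \<bar>?B $$ (0, l)\<bar> \<le> nat \<bar>A $$ (0, l)\<bar>" using A lt by auto
        show "\<exists>l\<in>{..<Suc m}. nat \<bar>?B $$ (0, l)\<bar> < nat \<bar>A $$ (0, l)\<bar>"
          using A ij lt by (intro bexI[of _ j]) auto
      qed simp
      from less.hyps[OF this B(1)] less.prems(2) B(2) obtain T where
        "finite T" "int (card T) = \<bar>det A\<bar>" "lattice_transversal (Suc m) ?B T" by auto
      thus ?thesis using lattice_transversal_addcol[OF A ij(1-3)] by blast
    next
      case False
      have "\<exists>p<Suc m. A $$ (0, p) \<noteq> 0"
      proof (rule ccontr)
        assume "\<not> ?thesis"
        hence "det A = 0" using laplace_expansion_row[OF A, of 0] by simp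
        thus False using less.prems by simp
      qed
      then obtain p where p: "p < Suc m" "A $$ (0, p) \<noteq> 0" by auto
      \<comment> \<open>Of two nonzero entries one could still reduce the other, contrary to the
        case assumption.\<close>
      have zero: "A $$ (0, j) = 0" if "j < Suc m" "j \<noteq> p" for j
        using False p that by (metis linorder_le_cases)
      define B where "B = swapcols 0 p A"
      have B: "B \<in> carrier_mat (Suc m) (Suc m)" using A by (simp add: B_def)
      have detB: "\<bar>det B\<bar> = \<bar>det A\<bar>"
      proof (cases "p = 0")
        case True
        hence "B = A" unfolding B_def using A by (intro eq_matI) auto
        thus ?thesis by simp
      next
        case False
        thus ?thesis unfolding B_def using det_swapcols[of 0 "Suc m" p A] A p by simp
      qed
      have B0: "B $$ (0, 0) \<noteq> 0" and Bz: "\<And>j. j < m \<Longrightarrow> B $$ (0, Suc j) = 0"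
        using A p zero by (auto simp: B_def)
      let ?D = "mat_delete B 0 0"
      have "det B = (\<Sum>j<Suc m. B $$ (0, j) * cofactor B 0 j)" by (rule laplace_expansion_row[OF B]) simp
      also have "\<dots> = B $$ (0, 0) * det ?D"
        unfolding sum.lessThan_Suc_shift using Bz by (simp add: cofactor_def)
      finally have det: "det B = B $$ (0, 0) * det ?D" .
      have "?D \<in> carrier_mat m m" using mat_delete_carrier[OF B] by simp
      from Suc.IH[OF this] det detB less.prems(2) obtain T where
        T: "finite T" "int (card T) = \<bar>det ?D\<bar>" "lattice_transversal m ?D T" by force
      let ?S = "{0..<\<bar>B $$ (0, 0)\<bar>} \<times> T"
      have inj: "inj_on (\<lambda>(a, s). vCons a s) ?S" by (auto simp: inj_on_def)
      have "int (card ((\<lambda>(a, s). vCons a s) ` ?S)) = \<bar>det A\<bar>"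
        using T(1,2) det detB by (simp add: card_image[OF inj] card_cartesian_product abs_mult)
      moreover have "lattice_transversal (Suc m) A ((\<lambda>(a, s). vCons a s) ` ?S)"
        using lattice_transversal_first_row_zero[OF B Bz B0 T(3)] p
        unfolding B_def by (intro lattice_transversal_swapcols[OF A, of 0 p]) auto
      moreover have "finite ((\<lambda>(a, s). vCons a s) ` ?S)" using T(1) by simp
      ultimately show ?thesis by blast
    qed
  qed
qed

section \<open>Periodic integer sequences\<close>

definition periodic :: "nat \<Rightarrow> (int \<Rightarrow> 'a) \<Rightarrow> bool" where
  "periodic k x \<longleftrightarrow> k \<ge> 1 \<and> (\<forall>n. x (n + int k) = x n)"

lemma periodic_add_mult:
  assumes "periodic k x"
  shows "x (n + int k * m) = x n"
proof (induction m rule: int_induct[of _ 0])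
  case (step1 i)
  have "x (n + int k * i + int k) = x (n + int k * i)" using assms by (simp add: periodic_def)
  thus ?case using step1 by (simp add: algebra_simps)
next
  case (step2 i)
  have "x (n + int k * (i - 1) + int k) = x (n + int k * (i - 1))" using assms by (simp add: periodic_def)
  thus ?case using step2 by (simp add: algebra_simps)
qed simp

lemma periodic_mod: "periodic k x \<Longrightarrow> x (n mod int k) = x n"
  using periodic_add_mult[of k x "n mod int k" "n div int k"] by simp

lemma periodic_multiple: "periodic k x \<Longrightarrow> m \<ge> 1 \<Longrightarrow> periodic (k * m) x"
  using periodic_add_mult[of k x _ "int m"] by (simp add: periodic_def)

lemma periodic_common:
  assumes "periodic k x" "periodic l y"
  shows "periodic (k * l) x" "periodic (k * l) y"
  using periodic_multiple[OF assms(1), of l] periodic_multiple[OF assms(2), of k] assms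
  by (simp_all add: periodic_def mult.commute)

lemma periodic_comp: "periodic k x \<Longrightarrow> periodic k (\<lambda>n. f (x n))"
  by (simp add: periodic_def)

lemma periodic_comp2: "periodic k x \<Longrightarrow> periodic k y \<Longrightarrow> periodic k (\<lambda>n. f (x n) (y n))"
  by (simp add: periodic_def)

lemma periodic_translate: "periodic k x \<Longrightarrow> periodic k (\<lambda>n. x (n + c))"
  unfolding periodic_def by (metis add.assoc add.commute)

lemma periodic_const: "k \<ge> 1 \<Longrightarrow> periodic k (\<lambda>n. c)"
  by (simp add: periodic_def)

lemma periodic_eqI:
  assumes "periodic k x" "periodic k y" "\<And>j. j < k \<Longrightarrow> x (int j) = y (int j)"
  shows "x = y"
proof
  fix n
  have k: "k \<ge> 1" using assms(1) by (simp add: periodic_def)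
  have "x (int (nat (n mod int k))) = y (int (nat (n mod int k)))"
    using k by (intro assms(3)) (simp add: nat_less_iff)
  thus "x n = y n" using k by (simp add: periodic_mod[OF assms(1)] periodic_mod[OF assms(2)])
qed

lemma finite_range_periodic:
  assumes "periodic k x"
  shows "finite (range x)"
proof -
  have "range x \<subseteq> x ` {0..<int k}"
  proof clarify
    fix n
    have "n mod int k \<in> {0..<int k}" using assms by (auto simp: periodic_def)
    thus "x n \<in> x ` {0..<int k}" using periodic_mod[OF assms, of n] by (metis imageI)
  qed
  thus ?thesis by (rule finite_subset) simp
qed

lemma periodic_attains_max:
  fixes x :: "int \<Rightarrow> 'a :: linorder"
  assumes "periodic k x"
  shows "\<exists>m. \<forall>n. x n \<le> x m"
proof -
  have "Max (range x) \<in> range x" using finite_range_periodic[OF assms] by (intro Max_in) auto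
  then obtain m where "x m = Max (range x)" by auto
  thus ?thesis using Max_ge[OF finite_range_periodic[OF assms]] by (metis rangeI)
qed

lemma periodic_seq_periodic: "length w \<ge> 1 \<Longrightarrow> periodic (length w) (periodic_seq w)"
  by (simp add: periodic_def periodic_seq_def)

lemma periodic_seq_nth: "j < length w \<Longrightarrow> periodic_seq w (int j) = w ! j"
  by (simp add: periodic_seq_def)

lemma periodic_seq_block:
  assumes "periodic k s"
  shows "periodic_seq (map (\<lambda>j. s (int j)) [0..<k]) = s"
proof (rule periodic_eqI[OF _ assms])
  show "periodic k (periodic_seq (map (\<lambda>j. s (int j)) [0..<k]))"
    using periodic_seq_periodic[of "map (\<lambda>j. s (int j)) [0..<k]"] assms by (simp add: periodic_def)
qed (simp add: periodic_seq_nth)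

lemma periodic_seq_inject: "length v = length w \<Longrightarrow> periodic_seq v = periodic_seq w \<Longrightarrow> v = w"
  by (metis nth_equalityI periodic_seq_nth)

section \<open>The firing operator on sequences\<close>

locale wheel =
  fixes q t :: nat
  assumes t_pos: "t \<ge> 1"
begin

text \<open>If \<open>a n\<close> counts the firings at position \<open>n\<close>, this is the net
  loss there: each firing at \<open>n + 1\<close> sends one unit to \<open>n\<close>, each firing at
  \<open>n - 1\<close> sends \<open>q\<close>.\<close>

definition lap :: "(int \<Rightarrow> int) \<Rightarrow> int \<Rightarrow> int" where
  "lap a n = (1 + int q + int t) * a n - a (n + 1) - int q * a (n - 1)"

text \<open>The number of edges from \<open>A\<close> into \<open>v\<close> after the rim has been
  unrolled to the integer line.\<close>

definition inflow :: "int set \<Rightarrow> int \<Rightarrow> nat" where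
  "inflow A v = of_bool (v + 1 \<in> A) + q * of_bool (v - 1 \<in> A)"

text \<open>Dhar's burning criterion: no nonempty set of vertices is a forbidden subconfiguration. Since
  the sets need not be periodic, the notion does not refer to the length of a period.\<close>

definition good :: "(int \<Rightarrow> nat) \<Rightarrow> bool" where
  "good s \<longleftrightarrow> (\<forall>n. s n \<le> q + t) \<and> (\<forall>A. A \<noteq> {} \<longrightarrow> (\<exists>v\<in>A. inflow A v \<le> s v))"

text \<open>The rule for constants accounts for the bank: one bank firing adds \<open>t\<close>
  everywhere, which is \<open>lap\<close> of the constant 1. Bank firings are therefore invisible
  modulo \<open>lap\<close>.\<close>

lemma lap_add: "lap (\<lambda>n. a n + b n) n = lap a n + lap b n"
  and lap_diff: "lap (\<lambda>n. a n - b n) n = lap a n - lap b n"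
  and lap_uminus: "lap (\<lambda>n. - a n) n = - lap a n"
  and lap_mult: "lap (\<lambda>n. c * a n) n = c * lap a n"
  and lap_const: "lap (\<lambda>n. c) n = int t * c"
  and lap_translate: "lap (\<lambda>n. a (n + c)) n = lap a (n + c)"
  by (simp_all add: lap_def algebra_simps)

lemma periodic_lap: "periodic k a \<Longrightarrow> periodic k (lap a)"
  unfolding lap_def[abs_def]
  using periodic_translate[of k a 1] periodic_translate[of k a "- 1"] by (simp add: periodic_def)

text \<open>Goodness of \<open>s'\<close> is applied to the set where \<open>a\<close> attains its
  maximum \<open>m\<close>. Neighbours outside this set contribute at most \<open>m - 1\<close>, so
  for \<open>m \<ge> 1\<close> every point of the set has less than its inflow in
  \<open>s'\<close>.\<close>

lemma lap_maximum_principle: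
  assumes s: "\<And>n. s n \<le> q + t" and s': "good s'" and a: "periodic k a"
    and eq: "\<And>n. int (s n) - int (s' n) = lap a n"
  shows "a n \<le> 0"
proof (rule ccontr)
  assume "\<not> a n \<le> 0"
  obtain p where p: "\<And>n. a n \<le> a p" using periodic_attains_max[OF a] by auto
  define m where "m = a p"
  have m: "m \<ge> 1" using p[of n] \<open>\<not> a n \<le> 0\<close> by (simp add: m_def)
  define A where "A = {n. a n = m}"
  have "A \<noteq> {}" by (auto simp: A_def m_def)
  then obtain v where v: "v \<in> A" "inflow A v \<le> s' v" using s' by (auto simp: good_def)
  have bound: "a n \<le> m - 1 + of_bool (n \<in> A)" for n using p[of n] by (auto simp: A_def m_def)
  have av: "a v = m" using v(1) by (simp add: A_def)
  have "int (s' v) = int (s v) - (1 + int q + int t) * m + a (v + 1) + int q * a (v - 1)"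
    using eq[of v] by (simp add: lap_def av)
  also have "\<dots> \<le> int (q + t) - (1 + int q + int t) * m + (m - 1 + of_bool (v + 1 \<in> A))
      + int q * (m - 1 + of_bool (v - 1 \<in> A))"
    using bound[of "v + 1"] mult_left_mono[OF bound[of "v - 1"], of "int q"] s[of v] by linarith
  also have "\<dots> = int t - int t * m - 1 + int (inflow A v)"
    by (simp add: inflow_def algebra_simps)
  also have "\<dots> < int (inflow A v)"
    using mult_left_mono[OF m, of "int t"] by simp
  finally show False using v(2) by simp
qed

lemma good_unique:
  assumes "good s" "good s'" "periodic k a" "\<And>n. int (s n) - int (s' n) = lap a n"
  shows "a n = 0" "s = s'"
proof -
  have "a n \<le> 0" for n
    using assms by (intro lap_maximum_principle[of s s' k a]) (auto simp: good_def)
  moreover have "- a n \<le> 0" for n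
    using assms periodic_comp[of k a uminus]
    by (intro lap_maximum_principle[of s' s k "\<lambda>n. - a n"]) (auto simp: good_def lap_uminus simp flip: assms(4))
  ultimately have a: "a n = 0" for n by (meson eq_iff neg_le_0_iff_le)
  thus "a n = 0" by simp
  show "s = s'"
  proof
    fix n show "s n = s' n" using assms(4)[of n] by (simp add: lap_def a)
  qed
qed

lemma good_max: "good (\<lambda>n. q + t)"
proof -
  have "inflow A v \<le> q + t" for A v using t_pos by (auto simp: inflow_def)
  thus ?thesis by (auto simp: good_def)
qed

text \<open>A kernel element links a good sequence to itself, so uniqueness applies. The constant
  \<open>q + t\<close> serves as the good sequence; inflows are at most \<open>1 + q\<close>, which
  it covers since \<open>t \<ge> 1\<close>.\<close>

lemma lap_injective:
  assumes "periodic k a" "\<And>n. lap a n = 0"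
  shows "a n = 0"
  using good_unique(1)[OF good_max good_max assms(1)] assms(2) by simp

lemma lap_eq_imp_eq:
  assumes "periodic k a" "periodic l b" "\<And>n. lap a n = lap b n"
  shows "a n = b n"
proof -
  have "periodic (k * l) (\<lambda>n. a n - b n)"
    using periodic_common[OF assms(1,2)] by (rule periodic_comp2)
  from lap_injective[OF this] show ?thesis using assms(3) by (simp add: lap_diff)
qed

section \<open>Critical configurations\<close>

definition vertex_ind :: "nat \<Rightarrow> nat \<Rightarrow> int \<Rightarrow> int" where
  "vertex_ind k i n = of_bool (n mod int k = int i)"

lemma periodic_vertex_ind: "k \<ge> 1 \<Longrightarrow> periodic k (vertex_ind k i)"
  by (simp add: periodic_def vertex_ind_def)

text \<open>Rim vertex \<open>Suc j\<close> sits at position \<open>j\<close>. Loops for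
  \<open>k = 1\<close> and merged edges for \<open>k = 2\<close> come out right because then both
  neighbours of a position lie in one residue class.\<close>

lemma wheel_edges_rim:
  assumes "i < k" "j < k"
  shows "int (wheel_edges k q t (Suc i) (Suc j)) =
    vertex_ind k i (int j + 1) + int q * vertex_ind k i (int j - 1)"
proof -
  have "(int j + 1) mod int k = int i \<longleftrightarrow> Suc j = rim_prev k (Suc i)"
  proof (cases "Suc j = k")
    case True
    have "(int j + 1) mod int k = 0" using True by (metis mod_self of_nat_Suc add.commute)
    thus ?thesis using True assms by (auto simp: rim_prev_def)
  next
    case False
    have "(int j + 1) mod int k = int j + 1" using False assms by (intro mod_pos_pos_trivial) auto
    thus ?thesis using False assms by (auto simp: rim_prev_def)
  qed
  moreover have "(int j - 1) mod int k = int i \<longleftrightarrow> Suc j = rim_next k (Suc i)"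
  proof (cases "j = 0")
    case True
    have "(int j - 1) mod int k = int k - 1" using True assms by (simp add: zmod_minus1)
    thus ?thesis using True assms by (auto simp: rim_next_def)
  next
    case False
    have "(int j - 1) mod int k = int j - 1" using False assms by (intro mod_pos_pos_trivial) auto
    thus ?thesis using False assms by (auto simp: rim_next_def)
  qed
  ultimately show ?thesis unfolding wheel_edges_def vertex_ind_def by simp
qed

lemma wheel_outdeg_rim:
  assumes "i < k"
  shows "wheel_outdeg k q t (Suc i) = 1 + q + t"
    and "(\<Sum>j<k. wheel_edges k q t (Suc i) (Suc j)) = 1 + q"
proof -
  have "(\<Sum>j<k. wheel_edges k q t (Suc i) (Suc j)) =
      (\<Sum>j<k. (if Suc j = rim_prev k (Suc i) then 1 else 0)) + (\<Sum>j<k. (if Suc j = rim_next k (Suc i) then q else 0))"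
    by (simp add: wheel_edges_def sum.distrib)
  also have "(\<Sum>j<k. (if Suc j = rim_prev k (Suc i) then 1 else 0)) =
      (\<Sum>j<k. (if j = rim_prev k (Suc i) - 1 then 1 else 0 :: nat))"
    using assms by (intro sum.cong) (auto simp: rim_prev_def split: if_splits)
  also have "\<dots> = 1" using assms by (auto simp: rim_prev_def)
  also have "(\<Sum>j<k. (if Suc j = rim_next k (Suc i) then q else 0)) =
      (\<Sum>j<k. (if j = rim_next k (Suc i) - 1 then q else 0))"
    using assms by (intro sum.cong) (auto simp: rim_next_def split: if_splits)
  also have "\<dots> = q" using assms by (auto simp: rim_next_def)
  finally show s: "(\<Sum>j<k. wheel_edges k q t (Suc i) (Suc j)) = 1 + q" by simp
  have "wheel_outdeg k q t (Suc i) = wheel_edges k q t (Suc i) 0 + (\<Sum>j<k. wheel_edges k q t (Suc i) (Suc j))"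
    unfolding wheel_outdeg_def lessThan_Suc_atMost[symmetric] sum.lessThan_Suc_shift by simp
  thus "wheel_outdeg k q t (Suc i) = 1 + q + t" using s by (simp add: wheel_edges_def)
qed

lemma length_fire [simp]: "length (fire k q t C u) = k"
  by (simp add: fire_def)

lemma fire_nth: "j < k \<Longrightarrow> fire k q t C u ! j =
    C ! j + wheel_edges k q t u (Suc j) - (if Suc j = u then wheel_outdeg k q t u else 0)"
  by (simp add: fire_def del: upt_Suc)

lemma rim_can_fire_iff:
  "rim_can_fire k q t C u \<longleftrightarrow> (\<exists>i<k. u = Suc i \<and> 1 + q + t \<le> C ! i)"
proof (cases u)
  case (Suc i)
  thus ?thesis using wheel_outdeg_rim(1)[of i k] by (auto simp: rim_can_fire_def)
qed (simp add: rim_can_fire_def)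

lemma stable_iff: "stable k q t C \<longleftrightarrow> (\<forall>i<k. C ! i \<le> q + t)"
  unfolding stable_def rim_can_fire_iff by (auto simp: not_le less_Suc_eq_le)

lemma stable_iff_periodic_seq:
  assumes "length C = k" "k \<ge> 1"
  shows "stable k q t C \<longleftrightarrow> (\<forall>n. periodic_seq C n \<le> q + t)"
proof
  assume "stable k q t C"
  thus "\<forall>n. periodic_seq C n \<le> q + t"
    using assms by (auto simp: stable_iff periodic_seq_def nat_less_iff)
next
  assume "\<forall>n. periodic_seq C n \<le> q + t"
  thus "stable k q t C" using assms periodic_seq_nth[of _ C] by (metis stable_iff)
qed

lemma periodic_seq_fire_bank:
  assumes "length C = k" "k \<ge> 1"
  shows "periodic_seq (fire k q t C 0) n = periodic_seq C n + t"
  using assms by (simp add: periodic_seq_def fire_nth wheel_edges_def nat_less_iff)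

lemma periodic_seq_fire_rim:
  assumes C: "length C = k" and i: "i < k" "1 + q + t \<le> C ! i"
  shows "int (periodic_seq (fire k q t C (Suc i)) n) = int (periodic_seq C n) - lap (vertex_ind k i) n"
proof -
  have k: "k \<ge> 1" using i by simp
  have "(\<lambda>n. int (periodic_seq (fire k q t C (Suc i)) n)) = (\<lambda>n. int (periodic_seq C n) - lap (vertex_ind k i) n)"
  proof (rule periodic_eqI[of k])
    show "periodic k (\<lambda>n. int (periodic_seq (fire k q t C (Suc i)) n))"
      using periodic_seq_periodic[of "fire k q t C (Suc i)"] k periodic_comp by fastforce
    show "periodic k (\<lambda>n. int (periodic_seq C n) - lap (vertex_ind k i) n)"
      using periodic_seq_periodic[of C] periodic_lap[OF periodic_vertex_ind[OF k, of i]] k C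
      by (simp add: periodic_def)
    fix j assume j: "j < k"
    have "int (fire k q t C (Suc i) ! j) = int (C ! j) + int (wheel_edges k q t (Suc i) (Suc j))
        - (if j = i then 1 + int q + int t else 0)"
      unfolding fire_nth[OF j] using i by (auto simp: wheel_outdeg_rim(1))
    also have "\<dots> = int (C ! j) - lap (vertex_ind k i) (int j)"
      unfolding wheel_edges_rim[OF i(1) j] lap_def using j i by (simp add: vertex_ind_def)
    finally show "int (periodic_seq (fire k q t C (Suc i)) (int j)) =
        int (periodic_seq C (int j)) - lap (vertex_ind k i) (int j)"
      using j C by (simp add: periodic_seq_nth)
  qed
  thus ?thesis by (rule fun_cong)
qed

section \<open>Critical configurations pass the burning test\<close>

lemma fires_to_cases:
  assumes "fires_to k q t C C'"
  obtains "stable k q t C" "C' = fire k q t C 0"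
    | i where "i < k" "1 + q + t \<le> C ! i" "C' = fire k q t C (Suc i)"
  using assms unfolding fires_to_def legal_def rim_can_fire_iff by (auto split: if_splits)

text \<open>The vertices that have fired contain no forbidden subconfiguration: when a vertex fires,
  it is left with at least the money that its loops return, and every vertex that has
  fired before it receives its share.\<close>

definition fired :: "nat \<Rightarrow> nat list \<Rightarrow> nat list \<Rightarrow> nat \<Rightarrow> (int \<Rightarrow> int) \<Rightarrow> bool" where
  "fired k C C' m a \<longleftrightarrow> length C' = k \<and> periodic k a \<and> (\<forall>n. a n \<ge> 0) \<and>
     (\<forall>n. int (periodic_seq C' n) = int (periodic_seq C n) + int t * int m - lap a n) \<and>
     (\<forall>A. A \<noteq> {} \<longrightarrow> A \<subseteq> {n. a n > 0} \<longrightarrow> (\<exists>v\<in>A. inflow A v \<le> periodic_seq C' v))"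

text \<open>The second conclusion records that something has fired; for a recurrent configuration it
  rules out the trivial counts \<open>m = 0\<close> and \<open>a = 0\<close>.\<close>

lemma fired_step:
  assumes f: "fired k C C' m a" and k: "k \<ge> 1" and step: "fires_to k q t C' C''"
  shows "\<exists>m' a'. fired k C C'' m' a' \<and> (m' > 0 \<or> (\<exists>n. a' n > 0))"
  using step
proof (cases rule: fires_to_cases)
  case 1
  have C': "length C' = k" using f by (simp add: fired_def)
  have "\<exists>v\<in>A. inflow A v \<le> periodic_seq C' v + t" if "A \<noteq> {}" "A \<subseteq> {n. a n > 0}" for A
    using f that unfolding fired_def by (meson trans_le_add1)
  hence "fired k C C'' (Suc m) a"
    using f unfolding fired_def 1 periodic_seq_fire_bank[OF C' k] by (simp add: algebra_simps)
  thus ?thesis by blast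
next
  case (2 i)
  have C': "length C' = k" using f by (simp add: fired_def)
  let ?e = "vertex_ind k i" and ?R = "{n. n mod int k = int i}"
  have val: "int (periodic_seq C'' n) = int (periodic_seq C' n) - lap ?e n" for n
    unfolding 2(3) using periodic_seq_fire_rim[OF C' 2(1,2)] .
  have ev: "?e n = of_bool (n \<in> ?R)" for n by (simp add: vertex_ind_def)
  have val_in: "inflow ?R v \<le> periodic_seq C'' v" if "v \<in> ?R" for v
  proof -
    have "periodic_seq C' v = C' ! i" using that C' by (simp add: periodic_seq_def)
    hence "int (periodic_seq C'' v) \<ge> int (inflow ?R v)"
      unfolding val lap_def ev inflow_def using that 2(2) by simp
    thus ?thesis by simp
  qed
  have val_out: "periodic_seq C'' v = periodic_seq C' v + inflow ?R v" if "v \<notin> ?R" for v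
  proof -
    have "int (periodic_seq C'' v) = int (periodic_seq C' v + inflow ?R v)"
      unfolding val lap_def ev inflow_def using that by simp
    thus ?thesis by (simp only: of_nat_eq_iff)
  qed
  have mono: "inflow A v \<le> inflow B v + inflow ?R v" if "A \<subseteq> B \<union> ?R" for A B v
    using that unfolding inflow_def by (auto simp: of_bool_def)
  define a' where "a' n = a n + ?e n" for n
  have "fired k C C'' m a'"
    unfolding fired_def
  proof (intro conjI allI impI)
    show "length C'' = k" by (simp add: 2)
    show "periodic k a'" unfolding a'_def
      using f periodic_vertex_ind[OF k, of i] by (simp add: fired_def periodic_def)
    show "a' n \<ge> 0" for n using f by (simp add: a'_def fired_def vertex_ind_def)
    show "int (periodic_seq C'' n) = int (periodic_seq C n) + int t * int m - lap a' n" for n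
      using f unfolding val a'_def lap_add fired_def by simp
    fix A :: "int set" assume A: "A \<noteq> {}" "A \<subseteq> {n. a' n > 0}"
    show "\<exists>v\<in>A. inflow A v \<le> periodic_seq C'' v"
    proof (cases "A \<subseteq> ?R")
      case True
      then obtain v where "v \<in> A" "v \<in> ?R" using A(1) by blast
      moreover have "inflow A v \<le> inflow ?R v" using mono[of A "{}" v] True by (simp add: inflow_def)
      ultimately show ?thesis using val_in[of v] le_trans by blast
    next
      \<comment> \<open>Outside the class just fired, all members of \<open>A\<close> had fired
        earlier, so the old invariant yields \<open>v\<close>. The firing has since paid
        \<open>v\<close> the inflow from that class.\<close>
      case False
      have "A - ?R \<subseteq> {n. a n > 0}" using A(2) by (auto simp: a'_def vertex_ind_def)
      moreover have "A - ?R \<noteq> {}" using False by blast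
      ultimately obtain v where v: "v \<in> A - ?R" "inflow (A - ?R) v \<le> periodic_seq C' v"
        using f unfolding fired_def by meson
      have "inflow A v \<le> inflow (A - ?R) v + inflow ?R v" by (rule mono) auto
      thus ?thesis using v val_out[of v] by (intro bexI[of _ v]) auto
    qed
  qed
  moreover have "a' (int i) > 0"
  proof -
    have "a (int i) \<ge> 0" using f by (simp add: fired_def)
    thus ?thesis using 2(1) by (simp add: a'_def vertex_ind_def)
  qed
  ultimately show ?thesis by blast
qed

lemma reachable_fired:
  assumes "reachable k q t C C'" "length C = k" "k \<ge> 1"
  shows "\<exists>m a. fired k C C' m a"
  using assms(1) unfolding reachable_def
proof (induction rule: rtranclp_induct)
  case base
  have "fired k C C 0 (\<lambda>n. 0)" using assms by (simp add: fired_def periodic_const lap_const)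
  thus ?case by blast
next
  case (step D E)
  thus ?case using fired_step[OF _ assms(3)] by blast
qed

text \<open>A closed firing sequence has no net effect, so \<open>lap a\<close> equals
  \<open>lap\<close> of the constant \<open>m\<close> and injectivity gives \<open>a = m\<close>
  everywhere. As something fired, every vertex fired, and the invariant in \<open>fired\<close>
  covers all nonempty sets.\<close>

lemma critical_imp_good:
  assumes C: "critical k q t C" and k: "k \<ge> 1"
  shows "good (periodic_seq C)"
proof -
  have len: "length C = k" using C by (simp add: critical_def)
  from C have "(fires_to k q t)\<^sup>+\<^sup>+ C C" by (simp add: critical_def recurrent_def)
  hence "\<exists>D. reachable k q t C D \<and> fires_to k q t D C"
    unfolding reachable_def by (cases rule: tranclp.cases) (auto dest: tranclp_into_rtranclp)
  then obtain D where D: "reachable k q t C D" "fires_to k q t D C" by blast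
  from reachable_fired[OF D(1) len k] fired_step[OF _ k D(2)] obtain m a
    where f: "fired k C C m a" "m > 0 \<or> (\<exists>n. a n > 0)" by blast
  have "a n = int m" for n
  proof (rule lap_eq_imp_eq[of k a 1 "\<lambda>n. int m"])
    show "lap a n = lap (\<lambda>n. int m) n" for n
      using f(1) unfolding fired_def lap_const by (simp add: algebra_simps)
  qed (use f in \<open>simp_all add: fired_def periodic_const\<close>)
  hence "{n. a n > 0} = UNIV" using f(2) by auto
  thus ?thesis using f(1) C len k
    by (auto simp: good_def fired_def critical_def stable_iff_periodic_seq)
qed

section \<open>Every configuration reaches a critical one\<close>

lemma reaches_stable:
  assumes "length C = k"
  shows "\<exists>C'. reachable k q t C C' \<and> length C' = k \<and> stable k q t C'"
  using assms
proof (induction "\<Sum>j<k. C ! j" arbitrary: C rule: less_induct)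
  case less
  show ?case
  proof (cases "stable k q t C")
    case True
    thus ?thesis using less.prems by (auto simp: reachable_def)
  next
    case False
    then obtain i where i: "i < k" "1 + q + t \<le> C ! i" by (auto simp: stable_iff not_le)
    let ?D = "fire k q t C (Suc i)"
    have "int (\<Sum>j<k. ?D ! j) = (\<Sum>j<k. int (C ! j) + int (wheel_edges k q t (Suc i) (Suc j))
        - (if j = i then 1 + int q + int t else 0))"
      unfolding of_nat_sum using i by (intro sum.cong refl) (auto simp: fire_nth wheel_outdeg_rim(1))
    also have "\<dots> = int (\<Sum>j<k. C ! j) + int (\<Sum>j<k. wheel_edges k q t (Suc i) (Suc j)) - (1 + int q + int t)"
      using i by (simp add: sum.distrib sum_subtractf)
    \<comment> \<open>Each rim firing loses \<open>t\<close> to the hub, so the total on the rim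
      strictly decreases.\<close>
    also have "\<dots> < int (\<Sum>j<k. C ! j)" unfolding wheel_outdeg_rim(2)[OF i(1)] using t_pos by simp
    finally have "(\<Sum>j<k. ?D ! j) < (\<Sum>j<k. C ! j)" by linarith
    from less.hyps[OF this] obtain C' where C': "reachable k q t ?D C'" "length C' = k" "stable k q t C'"
      by auto
    have "fires_to k q t C ?D"
      unfolding fires_to_def legal_def rim_can_fire_iff using less.prems i
      by (intro conjI exI[of _ "Suc i"]) auto
    hence "reachable k q t C C'" using C'(1) unfolding reachable_def by (rule converse_rtranclp_into_rtranclp)
    thus ?thesis using C' by blast
  qed
qed

lemma finite_tranclp_cycle:
  assumes "finite X" "x \<in> X" "\<And>y. y \<in> X \<Longrightarrow> \<exists>z\<in>X. R\<^sup>+\<^sup>+ y z"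
  shows "\<exists>z\<in>X. R\<^sup>*\<^sup>* x z \<and> R\<^sup>+\<^sup>+ z z"
proof -
  obtain f where f: "\<And>y. y \<in> X \<Longrightarrow> f y \<in> X \<and> R\<^sup>+\<^sup>+ y (f y)" using assms(3) by metis
  have X: "(f ^^ n) x \<in> X" for n by (induction n) (use assms f in auto)
  have R: "R\<^sup>*\<^sup>* ((f ^^ i) x) ((f ^^ (i + n)) x)" for i n
  proof (induction n)
    case (Suc n)
    have "R\<^sup>+\<^sup>+ ((f ^^ (i + n)) x) ((f ^^ (i + Suc n)) x)" using f[OF X, of "i + n"] by simp
    thus ?case using Suc by (meson rtranclp_trans tranclp_into_rtranclp)
  qed simp
  have "\<not> inj (\<lambda>n. (f ^^ n) x)"
    using finite_subset[of "range (\<lambda>n. (f ^^ n) x)" X] X assms(1) finite_imageD infinite_UNIV_nat by blast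
  then obtain i j where ij: "i < j" "(f ^^ i) x = (f ^^ j) x"
    unfolding inj_def by (metis linorder_neqE_nat)
  have "R\<^sup>+\<^sup>+ ((f ^^ i) x) ((f ^^ Suc i) x)" using f[OF X, of i] by simp
  moreover have "R\<^sup>*\<^sup>* ((f ^^ Suc i) x) ((f ^^ j) x)" using R[of "Suc i" "j - Suc i"] ij(1) by simp
  ultimately have "R\<^sup>+\<^sup>+ ((f ^^ i) x) ((f ^^ i) x)" using ij(2) by (metis tranclp_rtranclp_tranclp)
  thus ?thesis using X[of i] R[of 0 i] by auto
qed

lemma finite_stable: "finite {C. length C = k \<and> stable k q t C}"
proof (rule finite_subset)
  show "{C. length C = k \<and> stable k q t C} \<subseteq> {C. set C \<subseteq> {..q + t} \<and> length C = k}"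
    by (auto simp: stable_iff in_set_conv_nth)
qed (rule finite_lists_length_eq, simp)

text \<open>At a stable configuration the bank may fire, after which the rim is stabilized again.
  Among finitely many stable configurations this walk enters a cycle, whose members are
  recurrent.\<close>

lemma reaches_critical:
  assumes "length C = k"
  shows "\<exists>C'. reachable k q t C C' \<and> critical k q t C'"
proof -
  let ?X = "{C. length C = k \<and> stable k q t C}"
  obtain D where D: "reachable k q t C D" "D \<in> ?X" using reaches_stable[OF assms] by auto
  have "\<exists>F\<in>?X. (fires_to k q t)\<^sup>+\<^sup>+ E F" if "E \<in> ?X" for E
  proof -
    have "fires_to k q t E (fire k q t E 0)" using that by (auto simp: fires_to_def legal_def)
    moreover obtain F where "reachable k q t (fire k q t E 0) F" "F \<in> ?X"
      using reaches_stable[of "fire k q t E 0" k] by auto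
    ultimately show ?thesis unfolding reachable_def by (meson rtranclp_into_tranclp2)
  qed
  from finite_tranclp_cycle[OF finite_stable D(2) this] D(1) show ?thesis
    unfolding reachable_def critical_def recurrent_def by (auto intro: rtranclp_trans)
qed

text \<open>The configuration reaches a critical one, which is good as well; the two differ by
  \<open>lap\<close> of a periodic sequence and so coincide.\<close>

lemma good_imp_critical:
  assumes C: "length C = k" "k \<ge> 1" and g: "good (periodic_seq C)"
  shows "critical k q t C"
proof -
  obtain C' where C': "reachable k q t C C'" "critical k q t C'" using reaches_critical[OF C(1)] by auto
  from reachable_fired[OF C'(1) C] obtain m a where f: "fired k C C' m a" by auto
  have "periodic_seq C = periodic_seq C'"
  proof (rule good_unique(2)[OF g critical_imp_good[OF C'(2) C(2)]])
    show "periodic k (\<lambda>n. a n - int m)" using f by (simp add: fired_def periodic_def)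
    show "int (periodic_seq C n) - int (periodic_seq C' n) = lap (\<lambda>n. a n - int m) n" for n
      using f by (simp add: fired_def lap_diff lap_const)
  qed
  hence "C = C'" using C C'(2) by (intro periodic_seq_inject) (simp_all add: critical_def)
  thus ?thesis using C'(2) by simp
qed

end

section \<open>Polynomials in the shift operator\<close>

text \<open>The action of \<open>f(\<rho>)\<close> is defined on all integer sequences, because the
  preimage construction below passes through a sequence that need not be periodic.\<close>

definition shift_poly :: "int poly \<Rightarrow> (int \<Rightarrow> int) \<Rightarrow> int \<Rightarrow> int" where
  "shift_poly f x n = (\<Sum>i\<le>degree f. coeff f i * x (n + int i))"

lemma shift_poly_altdef:
  assumes "degree f \<le> N"
  shows "shift_poly f x n = (\<Sum>i\<le>N. coeff f i * x (n + int i))"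
  unfolding shift_poly_def
  by (rule sum.mono_neutral_left) (use assms in \<open>auto simp: coeff_eq_0\<close>)

lemma shift_poly_0 [simp]: "shift_poly 0 x n = 0"
  by (simp add: shift_poly_def)

lemma shift_poly_pCons: "shift_poly (pCons a f) x n = a * x n + shift_poly f x (n + 1)"
proof -
  have "shift_poly (pCons a f) x n = (\<Sum>i\<le>Suc (degree f). coeff (pCons a f) i * x (n + int i))"
    by (rule shift_poly_altdef) (rule degree_pCons_le)
  thus ?thesis unfolding sum.atMost_Suc_shift shift_poly_def by (simp add: add.assoc)
qed

lemma shift_poly_add: "shift_poly (f + g) x n = shift_poly f x n + shift_poly g x n"
proof -
  let ?N = "max (degree f) (degree g)"
  show ?thesis
    using shift_poly_altdef[of f ?N] shift_poly_altdef[of g ?N] shift_poly_altdef[of "f + g" ?N]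
    by (simp add: degree_add_le_max sum.distrib distrib_right)
qed

lemma shift_poly_smult: "shift_poly (smult c f) x n = c * shift_poly f x n"
  using shift_poly_altdef[of "smult c f" "degree f"]
  by (simp add: degree_smult_le shift_poly_def sum_distrib_left mult.assoc)

lemma shift_poly_mult: "shift_poly (f * g) x n = shift_poly f (shift_poly g x) n"
  by (induction f arbitrary: n) (simp_all add: shift_poly_add shift_poly_smult shift_poly_pCons)

lemma shift_poly_commute: "shift_poly f (shift_poly g x) n = shift_poly g (shift_poly f x) n"
  by (metis shift_poly_mult mult.commute)

lemma shift_poly_seq_add: "shift_poly f (\<lambda>n. x n + y n) n = shift_poly f x n + shift_poly f y n"
  by (induction f arbitrary: n) (simp_all add: shift_poly_pCons algebra_simps)

lemma shift_poly_seq_diff: "shift_poly f (\<lambda>n. x n - y n) n = shift_poly f x n - shift_poly f y n"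
  by (induction f arbitrary: n) (simp_all add: shift_poly_pCons algebra_simps)

lemma shift_poly_seq_0: "shift_poly f (\<lambda>n. 0) n = 0"
  by (simp add: shift_poly_def)

lemma shift_poly_monom_minus_1: "shift_poly (monom 1 k - 1) x n = x (n + int k) - x n"
proof -
  have "shift_poly (monom 1 k) x n = x (n + int k)" for n
    by (induction k arbitrary: n) (simp_all add: monom_0 monom_Suc shift_poly_pCons add.assoc)
  moreover have "monom 1 k - 1 = monom 1 k + [:- 1 :: int:]"
    by (metis diff_conv_add_uminus minus_pCons one_pCons neg_equal_0_iff_equal minus_zero)
  ultimately show ?thesis by (simp only: shift_poly_add) (simp add: shift_poly_pCons)
qed

lemma periodic_shift_poly: "periodic k x \<Longrightarrow> periodic k (shift_poly f x)"
  using periodic_translate[of k x] unfolding periodic_def shift_poly_def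
  by (auto intro!: sum.cong simp: ac_simps)

lemma periodic_iff_shift_poly: "periodic k x \<longleftrightarrow> k \<ge> 1 \<and> (\<forall>n. shift_poly (monom 1 k - 1) x n = 0)"
  by (simp add: periodic_def shift_poly_monom_minus_1)

lemma monom_minus_1_dvd: "monom 1 k - 1 dvd (monom 1 (k * m) - 1 :: int poly)"
proof -
  have "monom 1 (k * m) = (monom 1 k ^ m :: int poly)" by (simp add: monom_power)
  thus ?thesis by (metis dvd_triv_left power_diff_1_eq)
qed

text \<open>A \<open>k\<close>-periodic \<open>y\<close> is the image of \<open>n \<mapsto> (n div k) * y n\<close> under \<open>\<rho>\<^sup>k - 1 = f(\<rho>) g(\<rho>)\<close>.\<close>

lemma shift_poly_kernel_eq_image:
  assumes fg: "f * g = monom 1 k - 1" and k: "k \<ge> 1" and y: "\<And>n. shift_poly g y n = 0"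
  shows "\<exists>z. periodic k z \<and> (\<forall>n. shift_poly f z n = y n)"
proof -
  have gy: "shift_poly g y = (\<lambda>n. 0)" using y by auto
  have per: "periodic k y"
    unfolding periodic_iff_shift_poly fg[symmetric] shift_poly_mult gy using k by (simp add: shift_poly_seq_0)
  define z where "z = (\<lambda>n. (n div int k) * y n)"
  have "shift_poly (f * g) z n = y n" for n
    unfolding fg shift_poly_monom_minus_1 z_def using k per by (simp add: periodic_def algebra_simps)
  hence fgz: "shift_poly (f * g) z = y" by auto
  show ?thesis
  proof (intro exI[of _ "shift_poly g z"] conjI allI)
    show "shift_poly f (shift_poly g z) n = y n" for n using fgz shift_poly_mult[of f g z n] by simp
    show "periodic k (shift_poly g z)"
      unfolding periodic_iff_shift_poly fg[symmetric] using k y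
      by (simp add: shift_poly_commute[of _ g] fgz)
  qed
qed

context wheel
begin

lemma shift_poly_lap: "shift_poly f (lap x) n = lap (shift_poly f x) n"
proof (induction f arbitrary: n)
  case (pCons a f)
  have "shift_poly f (lap x) (n + 1) = lap (\<lambda>n. shift_poly f x (n + 1)) n"
    unfolding pCons.IH lap_translate by simp
  thus ?case unfolding shift_poly_pCons[abs_def] by (simp add: lap_add lap_mult)
qed (simp add: lap_def)

section \<open>Sequences modulo firing\<close>

text \<open>The period of the witness is left open, as suits a direct limit. Neither
  \<open>x\<close> nor \<open>y\<close> is restricted, so the laws of the relation hold without
  periodicity assumptions.\<close>

definition equivalent :: "(int \<Rightarrow> int) \<Rightarrow> (int \<Rightarrow> int) \<Rightarrow> bool" (infix \<open>\<approx>\<close> 50) where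
  "x \<approx> y \<longleftrightarrow> (\<exists>k a. periodic k a \<and> (\<forall>n. x n - y n = lap a n))"

lemma equivI: "periodic k a \<Longrightarrow> (\<And>n. x n - y n = lap a n) \<Longrightarrow> x \<approx> y"
  unfolding equivalent_def by blast

lemma equiv_refl: "x \<approx> x"
  by (rule equivI[of 1 "\<lambda>n. 0"]) (simp_all add: periodic_const lap_const)

lemma equiv_diff:
  assumes "x \<approx> y" "x' \<approx> y'"
  shows "(\<lambda>n. x n - x' n) \<approx> (\<lambda>n. y n - y' n)"
proof -
  from assms obtain k a l b where a: "periodic k a" "\<And>n. x n - y n = lap a n"
    and b: "periodic l b" "\<And>n. x' n - y' n = lap b n"
    unfolding equivalent_def by blast
  have "periodic (k * l) (\<lambda>n. a n - b n)"
    using periodic_common[OF a(1) b(1)] by (rule periodic_comp2)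
  thus ?thesis by (rule equivI) (simp add: lap_diff flip: a(2) b(2))
qed

lemma equiv_sym: "x \<approx> y \<Longrightarrow> y \<approx> x"
  using equiv_diff[OF equiv_diff[OF equiv_refl[of x]] equiv_refl[of "\<lambda>n. - y n"], of x y] by simp

lemma equiv_add: "x \<approx> y \<Longrightarrow> x' \<approx> y' \<Longrightarrow> (\<lambda>n. x n + x' n) \<approx> (\<lambda>n. y n + y' n)"
  using equiv_diff[of x y "\<lambda>n. - x' n" "\<lambda>n. - y' n"] equiv_diff[OF equiv_refl[of "\<lambda>n. 0"], of x' y'] by simp

lemma equiv_trans [trans]: "x \<approx> y \<Longrightarrow> y \<approx> z \<Longrightarrow> x \<approx> z"
  using equiv_diff[OF equiv_add[of x y y z] equiv_refl[of y]] by simp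

lemma equiv_shift_poly:
  assumes "x \<approx> y"
  shows "shift_poly f x \<approx> shift_poly f y"
proof -
  from assms obtain k a where a: "periodic k a" "\<And>n. x n - y n = lap a n"
    unfolding equivalent_def by blast
  have "shift_poly f x n - shift_poly f y n = shift_poly f (lap a) n" for n
    unfolding shift_poly_seq_diff[symmetric] a(2) ..
  thus ?thesis by (intro equivI[OF periodic_shift_poly[OF a(1)]]) (simp add: shift_poly_lap)
qed

lemma equiv_translate:
  assumes "x \<approx> y"
  shows "(\<lambda>n. x (n + c)) \<approx> (\<lambda>n. y (n + c))"
proof -
  from assms obtain k a where a: "periodic k a" "\<And>n. x n - y n = lap a n"
    unfolding equivalent_def by blast
  show ?thesis by (rule equivI[OF periodic_translate[OF a(1), of c]]) (simp add: a(2) lap_translate)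
qed

abbreviation emb :: "(int \<Rightarrow> nat) \<Rightarrow> int \<Rightarrow> int" where
  "emb s \<equiv> \<lambda>n. int (s n)"

definition good_seqs :: "(int \<Rightarrow> nat) set" where
  "good_seqs = {s. good s \<and> (\<exists>k. periodic k s)}"

text \<open>Only meaningful for periodic \<open>x\<close>.\<close>

definition normal_form :: "(int \<Rightarrow> int) \<Rightarrow> int \<Rightarrow> nat" where
  "normal_form x = (THE s. s \<in> good_seqs \<and> emb s \<approx> x)"

lemma good_equiv_imp_eq: "good s \<Longrightarrow> good s' \<Longrightarrow> emb s \<approx> emb s' \<Longrightarrow> s = s'"
  unfolding equivalent_def using good_unique(2) by blast

lemma reachable_equiv:
  assumes "reachable k q t C C'" "length C = k" "k \<ge> 1"
  shows "emb (periodic_seq C') \<approx> emb (periodic_seq C)"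
proof -
  from reachable_fired[OF assms] obtain m a where f: "fired k C C' m a" by auto
  show ?thesis
  proof (rule equivI)
    show "periodic k (\<lambda>n. int m - a n)" using f by (simp add: fired_def periodic_def)
    show "int (periodic_seq C' n) - int (periodic_seq C n) = lap (\<lambda>n. int m - a n) n" for n
      using f by (simp add: fired_def lap_diff lap_const)
  qed
qed

lemma critical_imp_good_seqs:
  assumes "critical k q t C" "k \<ge> 1"
  shows "periodic_seq C \<in> good_seqs"
  using critical_imp_good[OF assms] periodic_seq_periodic[of C] assms by (auto simp: good_seqs_def critical_def)

text \<open>Configurations have no negative entries, so \<open>int t * N\<close>, which is
  \<open>lap\<close> of the constant \<open>N\<close>, is added first. Stabilizing the block keeps
  its length, hence the period \<open>k\<close>.\<close>

lemma ex_good_equiv: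
  assumes x: "periodic k x"
  shows "\<exists>s. good s \<and> periodic k s \<and> emb s \<approx> x"
proof -
  have k: "k \<ge> 1" using x by (simp add: periodic_def)
  obtain p where p: "\<And>n. - x n \<le> - x p" using periodic_attains_max[OF periodic_comp[OF x]] by blast
  define N where "N = \<bar>x p\<bar>"
  have nonneg: "x n + int t * N \<ge> 0" for n
  proof -
    have "1 * N \<le> int t * N" using t_pos by (intro mult_right_mono) (auto simp: N_def)
    thus ?thesis using p[of n] unfolding N_def by linarith
  qed
  define C where "C = map (\<lambda>j. nat (x (int j) + int t * N)) [0..<k]"
  have C: "length C = k" by (simp add: C_def)
  have seqC: "periodic_seq C = (\<lambda>n. nat (x n + int t * N))"
    unfolding C_def by (rule periodic_seq_block[OF periodic_comp[OF x]])
  obtain C' where C': "reachable k q t C C'" "critical k q t C'" using reaches_critical[OF C] by auto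
  have "emb (periodic_seq C) \<approx> x"
    by (rule equivI[OF periodic_const[OF k, of N]]) (simp add: seqC nonneg lap_const)
  hence "emb (periodic_seq C') \<approx> x" by (rule equiv_trans[OF reachable_equiv[OF C'(1) C k]])
  moreover have "periodic k (periodic_seq C')"
    using periodic_seq_periodic[of C'] C'(2) k by (simp add: critical_def)
  ultimately show ?thesis using critical_imp_good[OF C'(2) k] by blast
qed

lemma good_seqs_translate:
  assumes "s \<in> good_seqs"
  shows "(\<lambda>n. s (n + c)) \<in> good_seqs"
proof -
  have s: "\<And>n. s n \<le> q + t" "\<And>A. A \<noteq> {} \<Longrightarrow> \<exists>v\<in>A. inflow A v \<le> s v"
    using assms unfolding good_seqs_def good_def by auto
  have "\<exists>v\<in>A. inflow A v \<le> s (v + c)" if A: "A \<noteq> {}" for A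
  proof -
    let ?B = "(\<lambda>n. n + c) ` A"
    have mem: "n \<in> ?B \<longleftrightarrow> n - c \<in> A" for n by force
    obtain v where v: "v \<in> ?B" "inflow ?B v \<le> s v" using s(2)[of ?B] A by blast
    have "inflow A (v - c) = inflow ?B v" by (simp add: inflow_def mem algebra_simps)
    thus ?thesis using v mem by (intro bexI[of _ "v - c"]) auto
  qed
  moreover obtain k where "periodic k s" using assms by (auto simp: good_seqs_def)
  ultimately show ?thesis
    using s(1) periodic_translate[of k s c] by (auto simp: good_seqs_def good_def)
qed

lemma normal_form_eqI:
  assumes "s \<in> good_seqs" "emb s \<approx> x"
  shows "normal_form x = s"
  unfolding normal_form_def
proof (rule the_equality)
  fix s' assume "s' \<in> good_seqs \<and> emb s' \<approx> x"
  thus "s' = s" using assms good_equiv_imp_eq equiv_trans equiv_sym unfolding good_seqs_def by blast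
qed (use assms in simp)

lemma normal_form:
  assumes "periodic k x"
  shows "normal_form x \<in> good_seqs" "emb (normal_form x) \<approx> x" "periodic k (normal_form x)"
proof -
  obtain s where s: "good s" "periodic k s" "emb s \<approx> x" using ex_good_equiv[OF assms] by auto
  hence "normal_form x = s" by (intro normal_form_eqI) (auto simp: good_seqs_def)
  thus "normal_form x \<in> good_seqs" "emb (normal_form x) \<approx> x" "periodic k (normal_form x)"
    using s by (auto simp: good_seqs_def)
qed

lemma normal_form_cong:
  assumes "periodic k x" "periodic l y" "x \<approx> y"
  shows "normal_form x = normal_form y"
  using normal_form[OF assms(2)] assms(3) equiv_trans equiv_sym by (intro normal_form_eqI) blast+

lemma normal_form_emb: "s \<in> good_seqs \<Longrightarrow> normal_form (emb s) = s"
  by (rule normal_form_eqI) (simp_all add: equiv_refl)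

lemma normal_form_eqD:
  assumes "periodic k x" "periodic l y" "normal_form x = normal_form y"
  shows "x \<approx> y"
  using normal_form(2)[OF assms(1)] normal_form(2)[OF assms(2)] assms(3) equiv_trans equiv_sym by metis

lemma good_seqs_periodic: "s \<in> good_seqs \<Longrightarrow> \<exists>k. periodic k (emb s)"
  unfolding good_seqs_def periodic_def by auto

lemma ex_periodic_add:
  assumes "\<exists>k. periodic k (x :: int \<Rightarrow> int)" "\<exists>k. periodic k (y :: int \<Rightarrow> int)"
  shows "\<exists>k. periodic k (\<lambda>n. x n + y n)"
  using assms periodic_common periodic_comp2[of _ x y "(+)"] by blast

section \<open>The limit group\<close>

lemma critical_add_periodic_seq:
  assumes v: "critical k q t v" and w: "critical k q t w" and k: "k \<ge> 1"
  shows "critical k q t (critical_add k q t v w)"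
    and "periodic_seq (critical_add k q t v w) =
      normal_form (\<lambda>n. int (periodic_seq v n) + int (periodic_seq w n))"
proof -
  let ?x = "\<lambda>n. int (periodic_seq v n) + int (periodic_seq w n)"
  have len: "length v = k" "length w = k" "length (map2 (+) v w) = k"
    using v w by (simp_all add: critical_def)
  have sum: "emb (periodic_seq (map2 (+) v w)) = ?x"
    using len k by (auto simp: periodic_seq_def nat_less_iff)
  have uniq: "periodic_seq C = normal_form ?x" if "critical k q t C" "reachable k q t (map2 (+) v w) C" for C
    using reachable_equiv[OF that(2) len(3) k] critical_imp_good_seqs[OF that(1) k]
    unfolding sum by (intro normal_form_eqI[symmetric])
  obtain C where C: "reachable k q t (map2 (+) v w) C" "critical k q t C"
    using reaches_critical[OF len(3)] by auto
  have "critical_add k q t v w = C" unfolding critical_add_def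
  proof (rule the_equality)
    fix C' assume C': "critical k q t C' \<and> reachable k q t (map2 (+) v w) C'"
    show "C' = C"
      using uniq[of C'] uniq[of C] C C' by (intro periodic_seq_inject) (auto simp: critical_def)
  qed (use C in simp)
  thus "critical k q t (critical_add k q t v w)" "periodic_seq (critical_add k q t v w) = normal_form ?x"
    using C uniq[of C] by simp_all
qed

lemma critical_block:
  assumes "s \<in> good_seqs" "periodic k s"
  shows "critical k q t (map (\<lambda>j. s (int j)) [0..<k])"
  using assms periodic_seq_block[OF assms(2)]
  by (intro good_imp_critical) (auto simp: good_seqs_def periodic_def)

lemma carrier_limit_group: "carrier (limit_group q t) = good_seqs"
proof (intro equalityI subsetI)
  fix s assume "s \<in> carrier (limit_group q t)"
  thus "s \<in> good_seqs" by (auto simp: limit_group_def critical_group_def intro: critical_imp_good_seqs)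
next
  fix s assume s: "s \<in> good_seqs"
  then obtain k where k: "periodic k s" by (auto simp: good_seqs_def)
  have "s = periodic_seq (map (\<lambda>j. s (int j)) [0..<k])" using periodic_seq_block[OF k] by simp
  moreover have "k \<in> {1..}" using k by (simp add: periodic_def)
  ultimately show "s \<in> carrier (limit_group q t)"
    using critical_block[OF s k] unfolding limit_group_def critical_group_def by fastforce
qed

text \<open>The product of two periods supplies a common critical group. Every other admissible
  group and choice of blocks gives the same sequence, since the normal form depends on
  \<open>r\<close> and \<open>s\<close> alone; this validates the definite description.\<close>

lemma mult_limit_group:
  assumes r: "r \<in> good_seqs" and s: "s \<in> good_seqs"
  shows "r \<otimes>\<^bsub>limit_group q t\<^esub> s = normal_form (\<lambda>n. int (r n) + int (s n))"
proof -
  from r s obtain k l where "periodic k r" "periodic l s" by (auto simp: good_seqs_def)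
  note kl = periodic_common[OF this]
  let ?block = "\<lambda>s. map (\<lambda>j. s (int j)) [0..<k * l]"
  have kl1: "k * l \<ge> 1" using kl(1) by (simp add: periodic_def)
  have block: "critical (k * l) q t (?block r)" "critical (k * l) q t (?block s)"
    using critical_block r s kl by auto
  have "(THE x. \<exists>k\<ge>1. \<exists>v\<in>carrier (critical_group k q t). \<exists>w\<in>carrier (critical_group k q t).
      r = periodic_seq v \<and> s = periodic_seq w \<and> x = periodic_seq (v \<otimes>\<^bsub>critical_group k q t\<^esub> w))
    = normal_form (\<lambda>n. int (r n) + int (s n))"
  proof (rule the_equality)
    show "\<exists>k\<ge>1. \<exists>v\<in>carrier (critical_group k q t). \<exists>w\<in>carrier (critical_group k q t).
        r = periodic_seq v \<and> s = periodic_seq w \<and>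
        normal_form (\<lambda>n. int (r n) + int (s n)) = periodic_seq (v \<otimes>\<^bsub>critical_group k q t\<^esub> w)"
      using kl1 block critical_add_periodic_seq(2)[OF block kl1] periodic_seq_block[OF kl(1)] periodic_seq_block[OF kl(2)]
      by (intro exI[of _ "k * l"] conjI bexI[of _ "?block r"] bexI[of _ "?block s"])
         (simp_all add: critical_group_def)
  qed (auto simp: critical_group_def critical_add_periodic_seq(2))
  thus ?thesis by (simp add: limit_group_def)
qed

text \<open>The zero class has a representative of period 1, whose block \<open>E\<close> is neutral
  for \<open>k = 1\<close>. A second neutral element is identified with \<open>E\<close> by adding
  it to \<open>E\<close>.\<close>

lemma one_limit_group: "\<one>\<^bsub>limit_group q t\<^esub> = normal_form (\<lambda>n. 0)"
proof -
  have p0: "periodic 1 (\<lambda>n::int. 0 :: int)" by (simp add: periodic_const)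
  note nf0 = normal_form[OF p0]
  define E where "E = map (\<lambda>j. normal_form (\<lambda>n. 0) (int j)) [0..<1]"
  have E: "critical 1 q t E" unfolding E_def by (rule critical_block[OF nf0(1,3)])
  have seqE: "periodic_seq E = normal_form (\<lambda>n. 0)" unfolding E_def by (rule periodic_seq_block[OF nf0(3)])
  have perC: "periodic 1 (emb (periodic_seq C))" if "critical 1 q t C" for C
    using that periodic_seq_periodic[of C] periodic_comp[of 1 "periodic_seq C" int] by (simp add: critical_def)
  have "(THE E. critical 1 q t E \<and> (\<forall>C. critical 1 q t C \<longrightarrow> critical_add 1 q t E C = C)) = E"
  proof (rule the_equality)
    show "critical 1 q t E \<and> (\<forall>C. critical 1 q t C \<longrightarrow> critical_add 1 q t E C = C)"
    proof (intro conjI allI impI)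
      fix C assume C: "critical 1 q t C"
      have "emb (periodic_seq C) \<approx> (\<lambda>n. int (periodic_seq E n) + int (periodic_seq C n))"
        using equiv_add[OF equiv_sym[OF nf0(2)] equiv_refl[of "emb (periodic_seq C)"]]
        unfolding seqE by simp
      hence "periodic_seq (critical_add 1 q t E C) = periodic_seq C"
        unfolding critical_add_periodic_seq(2)[OF E C order_refl]
        by (intro normal_form_eqI critical_imp_good_seqs[OF C]) auto
      thus "critical_add 1 q t E C = C"
        using critical_add_periodic_seq(1)[OF E C order_refl] C
        by (intro periodic_seq_inject) (auto simp: critical_def)
    qed fact
    fix F assume F: "critical 1 q t F \<and> (\<forall>C. critical 1 q t C \<longrightarrow> critical_add 1 q t F C = C)"
    hence "periodic_seq E = normal_form (\<lambda>n. int (periodic_seq F n) + int (periodic_seq E n))"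
      using critical_add_periodic_seq(2)[of 1 F E] E by simp
    also have "\<dots> = normal_form (emb (periodic_seq F))"
    proof (rule normal_form_cong)
      show "periodic 1 (\<lambda>n. int (periodic_seq F n) + int (periodic_seq E n))"
        using perC[of F] perC[of E] E F by (simp add: periodic_def)
      show "periodic 1 (emb (periodic_seq F))" using perC F by blast
      show "(\<lambda>n. int (periodic_seq F n) + int (periodic_seq E n)) \<approx> emb (periodic_seq F)"
        using equiv_add[OF equiv_refl[of "emb (periodic_seq F)"] nf0(2)] unfolding seqE by simp
    qed
    also have "\<dots> = periodic_seq F"
      using F by (intro normal_form_emb critical_imp_good_seqs[of 1]) auto
    finally show "F = E" using E F by (intro periodic_seq_inject) (auto simp: critical_def)
  qed
  thus ?thesis using seqE by (simp add: limit_group_def critical_group_def)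
qed

section \<open>Group laws, powers and shifts computed on representatives\<close>

lemma mult_normal_form:
  assumes "\<exists>k. periodic k x" "\<exists>k. periodic k y"
  shows "normal_form x \<otimes>\<^bsub>limit_group q t\<^esub> normal_form y = normal_form (\<lambda>n. x n + y n)"
proof -
  from assms obtain k l where k: "periodic k x" "periodic l y" by auto
  note nf = normal_form[OF k(1)] normal_form[OF k(2)]
  obtain m where m: "periodic m (\<lambda>n. x n + y n)" using ex_periodic_add[OF assms] by auto
  obtain m' where m': "periodic m' (\<lambda>n. int (normal_form x n) + int (normal_form y n))"
    using ex_periodic_add[OF good_seqs_periodic[OF nf(1)] good_seqs_periodic[OF nf(4)]] by auto
  show ?thesis unfolding mult_limit_group[OF nf(1,4)]
    by (rule normal_form_cong[OF m' m equiv_add[OF nf(2,5)]])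
qed

lemma good_seqs_eq_normal_form: "s \<in> good_seqs \<Longrightarrow> \<exists>x. s = normal_form x \<and> (\<exists>k. periodic k x)"
  by (metis normal_form_emb good_seqs_periodic)

lemma ex_periodic_mult: "\<exists>k. periodic k x \<Longrightarrow> \<exists>k. periodic k (\<lambda>n. c * x n :: int)"
  using periodic_comp[of _ x "(*) c"] by blast

lemma comm_group_limit_group: "comm_group (limit_group q t)"
proof (rule comm_groupI, unfold carrier_limit_group)
  let ?G = "limit_group q t"
  show "x \<otimes>\<^bsub>?G\<^esub> y \<in> good_seqs" if "x \<in> good_seqs" "y \<in> good_seqs" for x y
    unfolding mult_limit_group[OF that]
    using ex_periodic_add[OF good_seqs_periodic[OF that(1)] good_seqs_periodic[OF that(2)]] normal_form(1) by blast
  show "\<one>\<^bsub>?G\<^esub> \<in> good_seqs"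
    unfolding one_limit_group by (rule normal_form(1)[of 1]) (simp add: periodic_const)
  show "x \<otimes>\<^bsub>?G\<^esub> y \<otimes>\<^bsub>?G\<^esub> z = x \<otimes>\<^bsub>?G\<^esub> (y \<otimes>\<^bsub>?G\<^esub> z)"
    if "x \<in> good_seqs" "y \<in> good_seqs" "z \<in> good_seqs" for x y z
  proof -
    from that obtain a b c where abc: "x = normal_form a" "y = normal_form b" "z = normal_form c"
      "\<exists>k. periodic k a" "\<exists>k. periodic k b" "\<exists>k. periodic k c"
      using good_seqs_eq_normal_form by metis
    show ?thesis unfolding abc(1-3)
      by (simp add: mult_normal_form abc(4-6) ex_periodic_add add.assoc)
  qed
  show "x \<otimes>\<^bsub>?G\<^esub> y = y \<otimes>\<^bsub>?G\<^esub> x" if "x \<in> good_seqs" "y \<in> good_seqs" for x y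
    by (simp add: mult_limit_group that add.commute)
  have p0: "\<exists>k. periodic k (\<lambda>n::int. 0 :: int)" using periodic_const[of 1 0] by auto
  show "\<one>\<^bsub>?G\<^esub> \<otimes>\<^bsub>?G\<^esub> x = x" if "x \<in> good_seqs" for x
    using mult_normal_form[OF p0 good_seqs_periodic[OF that]] that
    by (simp add: one_limit_group normal_form_emb)
  show "\<exists>y\<in>good_seqs. y \<otimes>\<^bsub>?G\<^esub> x = \<one>\<^bsub>?G\<^esub>" if x: "x \<in> good_seqs" for x
  proof -
    have p: "\<exists>k. periodic k (\<lambda>n. - 1 * int (x n))" by (rule ex_periodic_mult[OF good_seqs_periodic[OF x]])
    have "normal_form (\<lambda>n. - 1 * int (x n)) \<in> good_seqs" using p normal_form(1) by blast
    moreover have "normal_form (\<lambda>n. - 1 * int (x n)) \<otimes>\<^bsub>?G\<^esub> x = \<one>\<^bsub>?G\<^esub>"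
      using mult_normal_form[OF p good_seqs_periodic[OF x]] x by (simp add: one_limit_group normal_form_emb)
    ultimately show ?thesis by blast
  qed
qed

lemma pow_normal_form:
  assumes x: "\<exists>k. periodic k x"
  shows "normal_form x [^]\<^bsub>limit_group q t\<^esub> (c :: int) = normal_form (\<lambda>n. c * x n)"
proof -
  let ?G = "limit_group q t"
  interpret G: comm_group ?G by (rule comm_group_limit_group)
  have nf: "normal_form x \<in> carrier ?G" if "\<exists>k. periodic k x" for x
    unfolding carrier_limit_group using that normal_form(1) by blast
  have nat_pow: "normal_form x [^]\<^bsub>?G\<^esub> m = normal_form (\<lambda>n. int m * x n)" for m :: nat
  proof (induction m)
    case (Suc m)
    thus ?case using mult_normal_form[OF ex_periodic_mult[OF x] x, of "int m"]
      by (simp add: algebra_simps)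
  qed (simp add: one_limit_group)
  show ?thesis
  proof (cases "c \<ge> 0")
    case True
    thus ?thesis unfolding int_pow_def2 nat_pow by simp
  next
    case False
    have "normal_form (\<lambda>n. c * x n) \<otimes>\<^bsub>?G\<^esub> normal_form (\<lambda>n. - c * x n) = \<one>\<^bsub>?G\<^esub>"
      using mult_normal_form[OF ex_periodic_mult[OF x] ex_periodic_mult[OF x], of c "- c"]
      by (simp add: one_limit_group)
    hence "inv\<^bsub>?G\<^esub> (normal_form (\<lambda>n. - c * x n)) = normal_form (\<lambda>n. c * x n)"
      by (rule G.inv_equality) (rule nf[OF ex_periodic_mult[OF x]])+
    thus ?thesis unfolding int_pow_def2 nat_pow using False by simp
  qed
qed

lemma shift_normal_form:
  assumes "\<exists>k. periodic k x"
  shows "shift (normal_form x) = normal_form (\<lambda>n. x (n + 1))"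
proof -
  from assms obtain k where k: "periodic k x" by auto
  note nf = normal_form[OF k]
  show ?thesis
  proof (rule normal_form_eqI[symmetric])
    show "shift (normal_form x) \<in> good_seqs"
      using nf(1) good_seqs_translate[of "normal_form x" 1] unfolding shift_def[abs_def] by simp
    show "emb (shift (normal_form x)) \<approx> (\<lambda>n. x (n + 1))"
      using equiv_translate[OF nf(2), of 1] by (simp add: shift_def)
  qed
qed

lemma poly_endo_limit_group:
  assumes s: "s \<in> good_seqs"
  shows "poly_endo (limit_group q t) f shift s = normal_form (shift_poly f (emb s))"
proof -
  let ?G = "limit_group q t"
  interpret G: comm_group ?G by (rule comm_group_limit_group)
  have p: "\<exists>k. periodic k (emb s)" by (rule good_seqs_periodic[OF s])
  have pt: "\<exists>k. periodic k (\<lambda>n. int (s (n + int j)))" for j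
    using p periodic_translate[of _ "emb s"] by blast
  have sh: "(shift ^^ j) s = normal_form (\<lambda>n. int (s (n + int j)))" for j
  proof (induction j)
    case (Suc j)
    show ?case using shift_normal_form[OF pt[of j]] by (simp add: Suc add.commute add.left_commute)
  qed (simp add: normal_form_emb[OF s])
  have fac: "(shift ^^ j) s [^]\<^bsub>?G\<^esub> (coeff f j) = normal_form (\<lambda>n. coeff f j * int (s (n + int j)))" for j
    unfolding sh by (rule pow_normal_form[OF pt])
  have pf: "\<exists>k. periodic k (\<lambda>n. coeff f j * int (s (n + int j)))" for j
    by (rule ex_periodic_mult[OF pt])
  have "(\<exists>k. periodic k (\<lambda>n. \<Sum>j\<in>A. coeff f j * int (s (n + int j)))) \<and>
      finprod ?G (\<lambda>j. (shift ^^ j) s [^]\<^bsub>?G\<^esub> (coeff f j)) A = normal_form (\<lambda>n. \<Sum>j\<in>A. coeff f j * int (s (n + int j)))"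
    if "finite A" for A
    using that
  proof (induction A)
    case empty
    have "periodic 1 (\<lambda>n::int. 0 :: int)" by (simp add: periodic_const)
    thus ?case by (auto simp: one_limit_group)
  next
    case (insert j A)
    have nfc: "normal_form (\<lambda>n. coeff f j * int (s (n + int j))) \<in> carrier ?G" for j
      unfolding carrier_limit_group using pf[of j] normal_form(1) by blast
    show ?case
      using insert nfc ex_periodic_add[OF pf[of j], of "\<lambda>n. \<Sum>j\<in>A. coeff f j * int (s (n + int j))"]
        mult_normal_form[OF pf[of j], of "\<lambda>n. \<Sum>j\<in>A. coeff f j * int (s (n + int j))"]
      by (simp add: fac Pi_def)
  qed
  from this[of "{..degree f}"] show ?thesis
    unfolding poly_endo_def shift_poly_def[abs_def] by simp
qed

definition poly_kernel :: "int poly \<Rightarrow> (int \<Rightarrow> nat) set" where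
  "poly_kernel f = {s \<in> good_seqs. shift_poly f (emb s) \<approx> (\<lambda>n. 0)}"

lemma ex_periodic_shift_poly: "\<exists>k. periodic k x \<Longrightarrow> \<exists>k. periodic k (shift_poly f x)"
  using periodic_shift_poly by blast

lemma kernel_poly_endo:
  "kernel (limit_group q t) (limit_group q t) (poly_endo (limit_group q t) f shift) = poly_kernel f"
proof -
  have "poly_endo (limit_group q t) f shift s = \<one>\<^bsub>limit_group q t\<^esub> \<longleftrightarrow> shift_poly f (emb s) \<approx> (\<lambda>n. 0)"
    if s: "s \<in> good_seqs" for s
  proof -
    obtain k where k: "periodic k (shift_poly f (emb s))"
      using ex_periodic_shift_poly[OF good_seqs_periodic[OF s]] by blast
    have p0: "periodic 1 (\<lambda>n::int. 0 :: int)" by (simp add: periodic_const)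
    show ?thesis unfolding poly_endo_limit_group[OF s] one_limit_group
      using normal_form_cong[OF k p0] normal_form_eqD[OF k p0] by blast
  qed
  thus ?thesis unfolding kernel_def poly_kernel_def carrier_limit_group by auto
qed

end

context wheel
begin

section \<open>Kernels of polynomials in the shift\<close>

lemma good_seqs_equiv_imp_eq: "s \<in> good_seqs \<Longrightarrow> s' \<in> good_seqs \<Longrightarrow> emb s \<approx> emb s' \<Longrightarrow> s = s'"
  using good_equiv_imp_eq by (simp add: good_seqs_def)

text \<open>Multiplying \<open>f(\<rho>) x = \<Delta> y\<close> by the complementary factor \<open>g(\<rho>)\<close> and cancelling the injective
  \<open>\<Delta>\<close> gives \<open>g(\<rho>) y = 0\<close>, so \<open>y = f(\<rho>) z\<close> and \<open>x - \<Delta> z\<close> is killed by \<open>f(\<rho>)\<close>.\<close>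

lemma shift_poly_equiv_0_imp_equiv_kernel:
  assumes f: "f dvd monom 1 k - 1" and k: "k \<ge> 1" and x: "periodic l x"
    and fx: "shift_poly f x \<approx> (\<lambda>n. 0)"
  shows "\<exists>w. x \<approx> w \<and> (\<forall>n. shift_poly f w n = 0)"
proof -
  from fx obtain m y where y: "periodic m y" "\<And>n. shift_poly f x n = lap y n"
    unfolding equivalent_def by auto
  \<comment> \<open>A common period of \<open>x\<close> and \<open>y\<close> that is also a multiple
    of \<open>k\<close>, so that \<open>f\<close> still divides
    \<open>monom 1 K - 1\<close>.\<close>
  define K where "K = k * (l * m)"
  have lm: "periodic (l * m) x" "periodic (l * m) y" using periodic_common[OF x y(1)] .
  have K: "K \<ge> 1" "periodic K x" "periodic K y"
    using periodic_multiple[OF lm(1) k] periodic_multiple[OF lm(2) k]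
    by (simp_all add: K_def mult.commute periodic_def)
  have "f dvd monom 1 K - 1" using f monom_minus_1_dvd unfolding K_def by (rule dvd_trans)
  then obtain g where g: "f * g = monom 1 K - 1" by (metis dvdE)
  have "shift_poly g y n = 0" for n
  proof (rule lap_injective[OF periodic_shift_poly[OF K(3)]])
    fix n
    have "lap (shift_poly g y) n = shift_poly g (lap y) n" by (rule shift_poly_lap[symmetric])
    also have "\<dots> = shift_poly g (shift_poly f x) n" using y(2) by presburger
    also have "\<dots> = shift_poly (monom 1 K - 1) x n" by (metis g shift_poly_mult shift_poly_commute)
    finally show "lap (shift_poly g y) n = 0" using K(2) by (simp add: periodic_iff_shift_poly)
  qed
  from shift_poly_kernel_eq_image[OF g K(1) this] obtain z
    where z: "periodic K z" "\<And>n. shift_poly f z n = y n" by auto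
  show ?thesis
  proof (intro exI[of _ "\<lambda>n. x n - lap z n"] conjI allI)
    show "x \<approx> (\<lambda>n. x n - lap z n)" by (rule equivI[OF z(1)]) simp
    have "shift_poly f z = y" using z(2) by auto
    thus "shift_poly f (\<lambda>n. x n - lap z n) n = 0" for n
      by (simp add: shift_poly_seq_diff shift_poly_lap y(2))
  qed
qed

text \<open>The class of \<open>v\<close> contains some \<open>w\<close> that
  \<open>g(\<rho>)\<close> kills exactly. With \<open>f * (g * h) = monom 1 k - 1\<close> the factor
  \<open>g * h\<close> kills \<open>w\<close> too, so \<open>w\<close> is an exact image under
  \<open>f(\<rho>)\<close>.\<close>

lemma poly_kernel_surj:
  assumes fg: "f * g dvd monom 1 k - 1" and k: "k \<ge> 1" and v: "v \<in> poly_kernel g"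
  shows "\<exists>s. s \<in> poly_kernel (f * g) \<and> shift_poly f (emb s) \<approx> emb v"
proof -
  from v have vg: "v \<in> good_seqs" "shift_poly g (emb v) \<approx> (\<lambda>n. 0)" by (auto simp: poly_kernel_def)
  obtain l where l: "periodic l (emb v)" using good_seqs_periodic[OF vg(1)] by auto
  have "g dvd monom 1 k - 1" using fg by (rule dvd_mult_right)
  from shift_poly_equiv_0_imp_equiv_kernel[OF this k l vg(2)] obtain w
    where w: "emb v \<approx> w" "\<And>n. shift_poly g w n = 0" by auto
  have gw: "shift_poly g w = (\<lambda>n. 0)" using w(2) by auto
  from fg obtain h where h: "f * (g * h) = monom 1 k - 1" by (metis dvdE mult.assoc)
  have "shift_poly (g * h) w n = 0" for n
    by (simp add: mult.commute[of g] shift_poly_mult gw shift_poly_seq_0)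
  from shift_poly_kernel_eq_image[OF h k this] obtain x
    where x: "periodic k x" "\<And>n. shift_poly f x n = w n" by auto
  have fx: "shift_poly f x = w" using x(2) by auto
  note nf = normal_form[OF x(1)]
  have "shift_poly f (emb (normal_form x)) \<approx> emb v"
    using equiv_shift_poly[OF nf(2), of f] equiv_sym[OF w(1)] equiv_trans unfolding fx by blast
  moreover have "shift_poly (f * g) x = (\<lambda>n. 0)"
    by (rule ext) (simp add: mult.commute[of f] shift_poly_mult fx gw)
  ultimately show ?thesis
    using nf(1) equiv_shift_poly[OF nf(2), of "f * g"] unfolding poly_kernel_def by auto
qed

text \<open>This counts a short exact sequence: \<open>f(\<rho>)\<close> maps the kernel of
  \<open>(f g)(\<rho>)\<close> onto that of \<open>g(\<rho>)\<close>, with the kernel of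
  \<open>f(\<rho>)\<close> as fibre. The map \<open>\<sigma>\<close> is a set-theoretic section, and
  \<open>(u, v)\<close> goes to the class of \<open>u + \<sigma> v\<close>.\<close>

lemma card_poly_kernel_mult:
  assumes fg: "f * g dvd monom 1 k - 1" and k: "k \<ge> 1"
  shows "card (poly_kernel (f * g)) = card (poly_kernel f) * card (poly_kernel g)"
proof -
  obtain \<sigma> where \<sigma>: "\<And>v. v \<in> poly_kernel g \<Longrightarrow> \<sigma> v \<in> poly_kernel (f * g)"
    "\<And>v. v \<in> poly_kernel g \<Longrightarrow> shift_poly f (emb (\<sigma> v)) \<approx> emb v"
    using poly_kernel_surj[OF fg k] by metis
  let ?F = "\<lambda>(u, v). normal_form (\<lambda>n. int (u n) + int (\<sigma> v n))"
  have G: "u \<in> good_seqs" if "u \<in> poly_kernel h" for u h using that by (simp add: poly_kernel_def)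
  have mult: "shift_poly (f * g) x = shift_poly g (shift_poly f x)" for x
    by (rule ext) (simp add: mult.commute[of f] shift_poly_mult)
  have F: "?F (u, v) \<in> good_seqs" "emb (?F (u, v)) \<approx> (\<lambda>n. int (u n) + int (\<sigma> v n))"
    "shift_poly f (emb (?F (u, v))) \<approx> emb v"
    if u: "u \<in> poly_kernel f" and v: "v \<in> poly_kernel g" for u v
  proof -
    obtain l where l: "periodic l (\<lambda>n. int (u n) + int (\<sigma> v n))"
      using ex_periodic_add[OF good_seqs_periodic[OF G[OF u]] good_seqs_periodic[OF G[OF \<sigma>(1)[OF v]]]] by auto
    show F1: "?F (u, v) \<in> good_seqs" "emb (?F (u, v)) \<approx> (\<lambda>n. int (u n) + int (\<sigma> v n))"
      using normal_form[OF l] by auto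
    have "shift_poly f (emb (?F (u, v))) \<approx> shift_poly f (\<lambda>n. int (u n) + int (\<sigma> v n))"
      by (rule equiv_shift_poly[OF F1(2)])
    also have "shift_poly f (\<lambda>n. int (u n) + int (\<sigma> v n)) =
        (\<lambda>n. shift_poly f (emb u) n + shift_poly f (emb (\<sigma> v)) n)"
      by (rule ext) (rule shift_poly_seq_add)
    also have "\<dots> \<approx> (\<lambda>n. 0 + emb v n)"
      using u \<sigma>(2)[OF v] by (intro equiv_add) (auto simp: poly_kernel_def)
    finally show "shift_poly f (emb (?F (u, v))) \<approx> emb v" by simp
  qed
  have "bij_betw ?F (poly_kernel f \<times> poly_kernel g) (poly_kernel (f * g))"
    unfolding bij_betw_def
  proof (intro conjI equalityI subsetI)
    show "inj_on ?F (poly_kernel f \<times> poly_kernel g)"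
    proof (rule inj_onI, clarify)
      fix u v u' v' assume u: "u \<in> poly_kernel f" "u' \<in> poly_kernel f"
        and v: "v \<in> poly_kernel g" "v' \<in> poly_kernel g"
        and eq: "normal_form (\<lambda>n. int (u n) + int (\<sigma> v n)) = normal_form (\<lambda>n. int (u' n) + int (\<sigma> v' n))"
      have "emb v \<approx> emb v'"
        using equiv_trans[OF equiv_sym[OF F(3)[OF u(1) v(1)]]] F(3)[OF u(2) v(2)] eq by simp
      hence vv: "v = v'" using v G by (blast intro: good_seqs_equiv_imp_eq)
      have "(\<lambda>n. int (u n) + int (\<sigma> v n)) \<approx> (\<lambda>n. int (u' n) + int (\<sigma> v n))"
        using equiv_trans[OF equiv_sym[OF F(2)[OF u(1) v(1)]]] F(2)[OF u(2) v(2)] eq vv by simp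
      from equiv_diff[OF this equiv_refl[of "emb (\<sigma> v)"]] have "emb u \<approx> emb u'" by simp
      thus "u = u' \<and> v = v'" using u G vv by (blast intro: good_seqs_equiv_imp_eq)
    qed
    fix s assume "s \<in> ?F ` (poly_kernel f \<times> poly_kernel g)"
    then obtain u v where uv: "u \<in> poly_kernel f" "v \<in> poly_kernel g" "s = ?F (u, v)" by auto
    have "shift_poly g (shift_poly f (emb s)) \<approx> (\<lambda>n. 0)"
      using equiv_shift_poly[OF F(3)[OF uv(1,2)], of g] uv(2) equiv_trans unfolding uv(3) poly_kernel_def by blast
    thus "s \<in> poly_kernel (f * g)" using F(1)[OF uv(1,2)] unfolding uv(3) poly_kernel_def mult by simp
  next
    fix s assume s: "s \<in> poly_kernel (f * g)"
    obtain l where l: "periodic l (emb s)" using good_seqs_periodic[OF G[OF s]] by auto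
    define v where "v = normal_form (shift_poly f (emb s))"
    note nv = normal_form[OF periodic_shift_poly[OF l, of f], folded v_def]
    have v: "v \<in> poly_kernel g"
      using nv equiv_shift_poly[OF nv(2), of g] s equiv_trans unfolding poly_kernel_def mult by blast
    obtain m where m: "periodic m (emb (\<sigma> v))" using good_seqs_periodic[OF G[OF \<sigma>(1)[OF v]]] by auto
    have lm: "periodic (l * m) (\<lambda>n. int (s n) - int (\<sigma> v n))"
      using periodic_common[OF l m] by (simp add: periodic_def)
    define u where "u = normal_form (\<lambda>n. int (s n) - int (\<sigma> v n))"
    note nu = normal_form[OF lm, folded u_def]
    have "shift_poly f (emb u) \<approx> shift_poly f (\<lambda>n. int (s n) - int (\<sigma> v n))"
      by (rule equiv_shift_poly[OF nu(2)])
    also have "shift_poly f (\<lambda>n. int (s n) - int (\<sigma> v n)) = (\<lambda>n. shift_poly f (emb s) n - shift_poly f (emb (\<sigma> v)) n)"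
      by (rule ext) (rule shift_poly_seq_diff)
    also have "\<dots> \<approx> (\<lambda>n. emb v n - emb v n)"
      using equiv_sym[OF nv(2)] \<sigma>(2)[OF v] by (rule equiv_diff)
    finally have "shift_poly f (emb u) \<approx> (\<lambda>n. 0)" by simp
    hence u: "u \<in> poly_kernel f" using nu(1) by (simp add: poly_kernel_def)
    have "(\<lambda>n. int (u n) + int (\<sigma> v n)) \<approx> emb s"
      using equiv_add[OF nu(2) equiv_refl[of "emb (\<sigma> v)"]] by simp
    hence "?F (u, v) = s" using G[OF s] equiv_sym by (auto intro: normal_form_eqI)
    thus "s \<in> ?F ` (poly_kernel f \<times> poly_kernel g)" using u v by (intro image_eqI[of _ _ "(u, v)"]) auto
  qed
  from bij_betw_same_card[OF this] show ?thesis by (simp add: card_cartesian_product)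
qed

text \<open>The translate of a good sequence by \<open>k\<close> is again good, so if the two are
  equivalent they are equal.\<close>

lemma poly_kernel_monom_minus_1:
  assumes k: "k \<ge> 1"
  shows "poly_kernel (monom 1 k - 1) = {s \<in> good_seqs. periodic k s}"
proof (intro equalityI subsetI)
  fix s assume "s \<in> poly_kernel (monom 1 k - 1)"
  hence s: "s \<in> good_seqs" "shift_poly (monom 1 k - 1) (emb s) \<approx> (\<lambda>n. 0)" by (auto simp: poly_kernel_def)
  have "(\<lambda>n. int (s (n + int k)) - int (s n)) \<approx> (\<lambda>n. 0)"
    using s(2) unfolding shift_poly_monom_minus_1[abs_def] .
  from equiv_add[OF this equiv_refl[of "emb s"]] have "emb (\<lambda>n. s (n + int k)) \<approx> emb s" by simp
  hence "(\<lambda>n. s (n + int k)) = s"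
    using s(1) good_seqs_translate by (intro good_seqs_equiv_imp_eq) auto
  hence "periodic k s" unfolding periodic_def using k by (metis (full_types))
  thus "s \<in> {s \<in> good_seqs. periodic k s}" using s by simp
next
  fix s assume s: "s \<in> {s \<in> good_seqs. periodic k s}"
  hence "shift_poly (monom 1 k - 1) (emb s) = (\<lambda>n. 0)"
    by (auto simp: shift_poly_monom_minus_1[abs_def] periodic_def)
  thus "s \<in> poly_kernel (monom 1 k - 1)" using s by (simp add: poly_kernel_def equiv_refl)
qed

lemma poly_kernel_mono:
  assumes "f dvd g"
  shows "poly_kernel f \<subseteq> poly_kernel g"
proof
  fix s assume s: "s \<in> poly_kernel f"
  obtain h where h: "g = h * f" using assms by (metis dvdE mult.commute)
  have g: "shift_poly g (emb s) = shift_poly h (shift_poly f (emb s))"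
    unfolding h by (rule ext) (rule shift_poly_mult)
  have "shift_poly h (shift_poly f (emb s)) \<approx> shift_poly h (\<lambda>n. 0)"
    using s by (intro equiv_shift_poly) (simp add: poly_kernel_def)
  also have "shift_poly h (\<lambda>n. 0) = (\<lambda>n. 0)" by (rule ext) (rule shift_poly_seq_0)
  finally show "s \<in> poly_kernel g" using s by (simp add: poly_kernel_def g)
qed

lemma finite_poly_kernel:
  assumes "f dvd monom 1 k - 1" "k \<ge> 1"
  shows "finite (poly_kernel f)"
proof (rule finite_subset[OF poly_kernel_mono[OF assms(1)]])
  have "{s \<in> good_seqs. periodic k s} \<subseteq> periodic_seq ` {C. length C = k \<and> stable k q t C}"
  proof clarify
    fix s assume "s \<in> good_seqs" "periodic k s"
    from critical_block[OF this] periodic_seq_block[OF this(2)]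
    show "s \<in> periodic_seq ` {C. length C = k \<and> stable k q t C}"
      by (intro image_eqI[of _ _ "map (\<lambda>j. s (int j)) [0..<k]"]) (auto simp: critical_def)
  qed
  thus "finite (poly_kernel (monom 1 k - 1))"
    unfolding poly_kernel_monom_minus_1[OF assms(2)]
    by (rule finite_subset) (intro finite_imageI finite_stable)
qed

lemma card_poly_kernel_1: "card (poly_kernel 1) = 1"
proof -
  have p0: "periodic 1 (\<lambda>n::int. 0 :: int)" by (simp add: periodic_const)
  have s1: "shift_poly 1 x = x" for x by (rule ext) (simp add: one_pCons shift_poly_pCons)
  have "poly_kernel 1 = {normal_form (\<lambda>n. 0)}"
  proof (intro equalityI subsetI)
    fix s assume "s \<in> poly_kernel 1"
    hence "normal_form (\<lambda>n. 0) = s"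
      unfolding poly_kernel_def s1 mem_Collect_eq by (elim conjE) (rule normal_form_eqI)
    thus "s \<in> {normal_form (\<lambda>n. 0)}" by simp
  next
    fix s assume "s \<in> {normal_form (\<lambda>n. 0)}"
    thus "s \<in> poly_kernel 1" using normal_form(1,2)[OF p0] by (simp add: poly_kernel_def s1)
  qed
  thus ?thesis by simp
qed

lemma card_poly_kernel_prod:
  assumes "finite D" "(\<Prod>d\<in>D. f d) dvd monom 1 k - 1" "k \<ge> 1"
  shows "card (poly_kernel (\<Prod>d\<in>D. f d)) = (\<Prod>d\<in>D. card (poly_kernel (f d)))"
  using assms(1,2)
proof (induction D)
  case (insert d D)
  have "f d * (\<Prod>d\<in>D. f d) dvd monom 1 k - 1" using insert by simp
  thus ?case using card_poly_kernel_mult[OF _ assms(3)] dvd_mult_right insert by auto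
qed (simp add: card_poly_kernel_1)

section \<open>The order of the critical group\<close>

definition wheel_int_matrix :: "nat \<Rightarrow> int mat" where
  "wheel_int_matrix k = mat k k (\<lambda>(i, j).
     (if i = j then 1 + int q + int t else 0)
     - (if j = (i + 1) mod k then int q else 0) - (if i = (j + 1) mod k then 1 else 0))"

lemma eval_qt_wheel_poly: "eval_qt (wheel_poly k) (int q) (int t) = det (wheel_int_matrix k)"
proof -
  interpret comm_ring_hom "\<lambda>P. eval_qt P (int q) (int t)" by (rule eval_qt_hom)
  have "map_mat (\<lambda>P. eval_qt P (int q) (int t)) (wheel_matrix k) = wheel_int_matrix k"
    by (intro eq_matI) (auto simp: wheel_matrix_def wheel_int_matrix_def hom_distribs,
        simp_all add: eval_qt_def var_q_def var_t_def)
  thus ?thesis unfolding wheel_poly_def using hom_det by metis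
qed

definition vec_seq :: "nat \<Rightarrow> int vec \<Rightarrow> int \<Rightarrow> int" where
  "vec_seq k v n = v $ nat (n mod int k)"

lemma periodic_vec_seq: "k \<ge> 1 \<Longrightarrow> periodic k (vec_seq k v)"
  by (simp add: periodic_def vec_seq_def)

lemma vec_seq_add:
  "k \<ge> 1 \<Longrightarrow> v \<in> carrier_vec k \<Longrightarrow> w \<in> carrier_vec k \<Longrightarrow> vec_seq k (v + w) n = vec_seq k v n + vec_seq k w n"
  by (simp add: vec_seq_def nat_less_iff)

lemma vec_seq_inject:
  assumes "k \<ge> 1" "v \<in> carrier_vec k" "w \<in> carrier_vec k" "vec_seq k v = vec_seq k w"
  shows "v = w"
proof (rule eq_vecI)
  fix i assume "i < dim_vec w"
  moreover have "vec_seq k v (int i) = vec_seq k w (int i)" using assms(4) by simp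
  ultimately show "v $ i = w $ i" using assms(1-3) by (simp add: vec_seq_def)
qed (use assms in auto)

lemma vec_seq_vec: "periodic k x \<Longrightarrow> vec_seq k (vec k (\<lambda>i. x (int i))) = x"
  by (rule ext) (simp add: vec_seq_def nat_less_iff periodic_mod, simp add: periodic_def periodic_mod nat_less_iff)

text \<open>The transpose appears because row \<open>i\<close> of the matrix lists what vertex
  \<open>i\<close> sends, while \<open>lap\<close> collects what a vertex receives; the determinant
  is the same.\<close>

lemma vec_seq_wheel_matrix:
  assumes k: "k \<ge> 1" and v: "v \<in> carrier_vec k"
  shows "vec_seq k (transpose_mat (wheel_int_matrix k) *\<^sub>v v) = lap (vec_seq k v)"
proof (rule periodic_eqI[OF periodic_vec_seq[OF k] periodic_lap[OF periodic_vec_seq[OF k]]])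
  fix i assume i: "i < k"
  define p where "p = nat ((int i - 1) mod int k)"
  define s where "s = nat ((int i + 1) mod int k)"
  have ps: "p < k" "s < k" using k by (simp_all add: p_def s_def nat_less_iff)
  have "(int i + 1) mod int k = int ((i + 1) mod k)" by (simp add: of_nat_mod add.commute)
  hence s: "s = (i + 1) mod k" by (simp only: s_def nat_int)
  have p: "i = (l + 1) mod k \<longleftrightarrow> l = p" if l: "l < k" for l
  proof -
    have "i = (l + 1) mod k \<longleftrightarrow> int i = (int l + 1) mod int k"
      by (metis of_nat_1 of_nat_add of_nat_eq_iff of_nat_mod)
    also have "\<dots> \<longleftrightarrow> int l = (int i - 1) mod int k"
    proof
      assume "int i = (int l + 1) mod int k"
      hence "(int i - 1) mod int k = int l mod int k" by (simp add: mod_simps)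
      thus "int l = (int i - 1) mod int k" using l by simp
    next
      assume "int l = (int i - 1) mod int k"
      hence "(int l + 1) mod int k = int i mod int k" by (simp add: mod_simps)
      thus "int i = (int l + 1) mod int k" using i by simp
    qed
    also have "\<dots> \<longleftrightarrow> l = p" unfolding p_def using k by auto
    finally show ?thesis .
  qed
  have "vec_seq k (transpose_mat (wheel_int_matrix k) *\<^sub>v v) (int i) =
      (\<Sum>l<k. wheel_int_matrix k $$ (l, i) * v $ l)"
    using i v by (simp add: vec_seq_def scalar_prod_def wheel_int_matrix_def atLeast0LessThan)
  also have "\<dots> = (\<Sum>l<k. (if l = i then (1 + int q + int t) * v $ l else 0) - (if l = p then int q * v $ l else 0)
      - (if l = s then v $ l else 0))"
    using i p by (intro sum.cong) (auto simp: wheel_int_matrix_def s algebra_simps)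
  also have "\<dots> = (1 + int q + int t) * v $ i - int q * v $ p - v $ s"
    unfolding sum_subtractf using i ps by simp
  also have "\<dots> = lap (vec_seq k v) (int i)"
    using i by (simp add: lap_def vec_seq_def p_def s_def)
  finally show "vec_seq k (transpose_mat (wheel_int_matrix k) *\<^sub>v v) (int i) = lap (vec_seq k v) (int i)" .
qed

text \<open>On \<open>k\<close>-periodic sequences equivalence is congruence modulo the column
  lattice of the transposed matrix, so the normal forms of lattice representatives enumerate the
  good ones.\<close>

lemma card_periodic_good_seqs:
  assumes k: "k \<ge> 1" and det: "det (wheel_int_matrix k) \<noteq> 0"
  shows "int (card {s \<in> good_seqs. periodic k s}) = \<bar>det (wheel_int_matrix k)\<bar>"
proof -
  let ?A = "transpose_mat (wheel_int_matrix k)"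
  have W: "wheel_int_matrix k \<in> carrier_mat k k" by (simp add: wheel_int_matrix_def)
  have A: "?A \<in> carrier_mat k k" "det ?A = det (wheel_int_matrix k)"
    using W det_transpose[OF W] by auto
  obtain T where T: "int (card T) = \<bar>det (wheel_int_matrix k)\<bar>" "lattice_transversal k ?A T"
    using lattice_index_eq_abs_det[OF A(1)] det A(2) by auto
  have TC: "T \<subseteq> carrier_vec k"
    and Tex: "\<And>x. x \<in> carrier_vec k \<Longrightarrow> \<exists>!s. s \<in> T \<and> (\<exists>v\<in>carrier_vec k. x = s + ?A *\<^sub>v v)"
    using T(2) by (auto simp: lattice_transversal_def)
  have Av: "?A *\<^sub>v v \<in> carrier_vec k" for v using A(1) by (intro carrier_vecI) simp
  note per = periodic_vec_seq[OF k]
  have equiv_vec: "vec_seq k x \<approx> vec_seq k y \<longleftrightarrow> (\<exists>v\<in>carrier_vec k. x = y + ?A *\<^sub>v v)"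
    if x: "x \<in> carrier_vec k" and y: "y \<in> carrier_vec k" for x y
  proof
    assume "vec_seq k x \<approx> vec_seq k y"
    then obtain l a where a: "periodic l a" "\<And>n. vec_seq k x n - vec_seq k y n = lap a n"
      unfolding equivalent_def by auto
    \<comment> \<open>The witness has an unrelated period \<open>l\<close>. As \<open>lap a\<close>
      is \<open>k\<close>-periodic, \<open>a\<close> and its translate by \<open>k\<close> have the
      same \<open>lap\<close>, and injectivity makes them equal.\<close>
    have "a (n + int k) = a n" for n
    proof (rule lap_eq_imp_eq[OF periodic_translate[OF a(1)] a(1)])
      show "lap (\<lambda>n. a (n + int k)) n = lap a n" for n
        unfolding lap_translate a(2)[symmetric] using per[of x] per[of y] by (simp add: periodic_def)
    qed
    hence ka: "periodic k a" using k by (simp add: periodic_def)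
    define v where "v = vec k (\<lambda>i. a (int i))"
    have v: "v \<in> carrier_vec k" "vec_seq k v = a" using vec_seq_vec[OF ka] by (simp_all add: v_def)
    have "vec_seq k x = vec_seq k (y + ?A *\<^sub>v v)"
    proof
      fix n show "vec_seq k x n = vec_seq k (y + ?A *\<^sub>v v) n"
        using a(2)[of n] unfolding vec_seq_add[OF k y Av] vec_seq_wheel_matrix[OF k v(1)] v(2) by simp
    qed
    hence "x = y + ?A *\<^sub>v v" using x y Av by (intro vec_seq_inject[OF k]) auto
    thus "\<exists>v\<in>carrier_vec k. x = y + ?A *\<^sub>v v" using v(1) by blast
  next
    assume "\<exists>v\<in>carrier_vec k. x = y + ?A *\<^sub>v v"
    then obtain v where v: "v \<in> carrier_vec k" "x = y + ?A *\<^sub>v v" by auto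
    show "vec_seq k x \<approx> vec_seq k y"
      by (rule equivI[OF per[of v]])
         (simp only: v(2) vec_seq_add[OF k y Av] vec_seq_wheel_matrix[OF k v(1)] add_diff_cancel_left')
  qed
  have "bij_betw (\<lambda>x. normal_form (vec_seq k x)) T {s \<in> good_seqs. periodic k s}"
    unfolding bij_betw_def
  proof (intro conjI equalityI subsetI)
    show "inj_on (\<lambda>x. normal_form (vec_seq k x)) T"
    proof (rule inj_onI)
      fix x y assume xy: "x \<in> T" "y \<in> T" "normal_form (vec_seq k x) = normal_form (vec_seq k y)"
      have C: "x \<in> carrier_vec k" "y \<in> carrier_vec k" using TC xy by auto
      have "\<exists>v\<in>carrier_vec k. x = y + ?A *\<^sub>v v"
        using normal_form_eqD[OF per per xy(3)] equiv_vec[OF C] by simp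
      moreover have "\<exists>v\<in>carrier_vec k. x = x + ?A *\<^sub>v v"
        using equiv_refl equiv_vec[OF C(1) C(1)] by simp
      ultimately show "x = y" using Tex[OF C(1)] xy by blast
    qed
    fix s assume "s \<in> (\<lambda>x. normal_form (vec_seq k x)) ` T"
    thus "s \<in> {s \<in> good_seqs. periodic k s}" using normal_form[OF per] by auto
  next
    fix s assume "s \<in> {s \<in> good_seqs. periodic k s}"
    hence s: "s \<in> good_seqs" "periodic k s" by auto
    define x where "x = vec k (\<lambda>i. int (s (int i)))"
    have x: "x \<in> carrier_vec k" "vec_seq k x = emb s"
      using vec_seq_vec[OF periodic_comp[OF s(2), of int]] by (simp_all add: x_def)
    obtain y where y: "y \<in> T" "\<exists>v\<in>carrier_vec k. x = y + ?A *\<^sub>v v" using Tex[OF x(1)] by auto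
    hence "emb s \<approx> vec_seq k y" using equiv_vec[OF x(1), of y] TC unfolding x(2) by auto
    hence "normal_form (vec_seq k y) = s" using s(1) by (intro normal_form_eqI)
    thus "s \<in> (\<lambda>x. normal_form (vec_seq k x)) ` T" using y(1) by auto
  qed
  thus ?thesis using T(1) bij_betw_same_card by fastforce
qed

lemma prod_card_poly_kernel_cyclotomic:
  assumes k: "k \<ge> 1"
  shows "(\<Prod>d | d dvd k. int (card (poly_kernel (cyclotomic d)))) =
    (\<Prod>d | d dvd k. eval_qt (WCyc d) (int q) (int t))"
proof -
  interpret comm_ring_hom "\<lambda>P. eval_qt P (int q) (int t)" by (rule eval_qt_hom)
  have pos: "d \<ge> 1" if "d dvd k" for d using that k by (cases d) auto
  have det: "det (wheel_int_matrix k) = (\<Prod>d | d dvd k. eval_qt (WCyc d) (int q) (int t))"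
    unfolding eval_qt_wheel_poly[symmetric] prod_WCyc[OF k] by (rule hom_prod)
  \<comment> \<open>This makes the determinant nonzero, as the index count requires, and removes its
    absolute value.\<close>
  have "\<dots> > 0" by (intro prod_pos eval_qt_WCyc_pos t_pos ballI pos) simp
  hence "int (card (poly_kernel (monom 1 k - 1))) = \<dots>"
    unfolding poly_kernel_monom_minus_1[OF k] det[symmetric]
    using card_periodic_good_seqs[OF k] by simp
  moreover have "card (poly_kernel (monom 1 k - 1)) = (\<Prod>d | d dvd k. card (poly_kernel (cyclotomic d)))"
    using card_poly_kernel_prod[OF finite_divisors[OF k], of cyclotomic k] k
    unfolding prod_cyclotomic[OF k] by simp
  ultimately show ?thesis by simp
qed

lemma card_poly_kernel_cyclotomic:
  "d \<ge> 1 \<Longrightarrow> int (card (poly_kernel (cyclotomic d))) = eval_qt (WCyc d) (int q) (int t)"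
proof (induction d rule: less_induct)
  case (less d)
  note d = less.prems
  let ?a = "\<lambda>d. int (card (poly_kernel (cyclotomic d)))" and ?b = "\<lambda>d. eval_qt (WCyc d) (int q) (int t)"
  let ?D = "{e. e dvd d \<and> e \<noteq> d}"
  have "(\<Prod>e\<in>?D. ?a e) = (\<Prod>e\<in>?D. ?b e)"
    using less.IH proper_divisor_bounds[OF d] by (intro prod.cong) auto
  moreover have "(\<Prod>e\<in>?D. ?b e) > 0"
    using proper_divisor_bounds[OF d] by (intro prod_pos ballI eval_qt_WCyc_pos t_pos) auto
  ultimately show ?case
    using prod_card_poly_kernel_cyclotomic[OF d]
    unfolding prod_divisors_split[OF d, of ?a] prod_divisors_split[OF d, of ?b] by simp
qed

end

theorem theorem8:
  fixes q t d :: nat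
  assumes "t \<ge> 1" and "d \<ge> 1"
  shows "finite (kernel (limit_group q t) (limit_group q t)
           (poly_endo (limit_group q t) (cyclotomic d) shift)) \<and>
         eval_qt (WCyc d) (int q) (int t) =
           int (card (kernel (limit_group q t) (limit_group q t)
             (poly_endo (limit_group q t) (cyclotomic d) shift)))"
proof -
  interpret wheel q t by unfold_locales fact
  have "cyclotomic d dvd monom 1 d - 1"
    unfolding prod_cyclotomic[OF assms(2), symmetric]
    by (rule dvd_prodI) (use finite_divisors[OF assms(2)] in auto)
  thus ?thesis
    unfolding kernel_poly_endo using finite_poly_kernel card_poly_kernel_cyclotomic assms(2) by simp
qed

end
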